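(* Suppose the following two convergence hypotheses hold: $$\lim_{h\to 0}\ \overset{\circ}{\beta}(h)^{-1}\inf_{w\in \mathcal S_{1,h}}\|v-w\|_{\mathcal H}=0\quad\text{for each } v\in\mathcal H,\qquad\text{and}\qquad \lim_{h\to 0}\delta_{\mathcal H}(A_h,A)=0 .$$ Then there exist $h_0>0$ and a constant $c>0$ such that for each $h<h_0$ and all $u\in\mathcal U$ with $\|u\|_{\mathcal H}=1$ there is a $u_h\in\mathcal U_h$ with $$\|u_h-Q_hu\|_{\mathcal H}\le c\,\overset{\circ}{\varepsilon}_{\mathcal H}(h)\,\delta_{\mathcal H}(\mathcal U,\mathcal S_{1,h}),$$ where $c$ is independent of $h$ and independent of the choice of $u$. (Here $A$ is not assumed bounded.)
   Context: Inner products and sesquilinear forms are conjugate linear in the first argument. $\mathcal H$ is a complex separable Hilbert space. $a(\cdot,\cdot)$ is a closed, densely defined, sectorial sesquilinear form in $\mathcal H$ with domain $\mathcal V=\mathrm{Dom}(a)$: for some fixed $\alpha,M>0$, $\mathrm{Re}\,a(v,v)\ge\alpha\|v\|_{\mathcal H}^2$ and $|\mathrm{Im}\,a(v,v)|\le M(\mathrm{Re}\,a(v,v)-\alpha\|v\|_{\mathcal H}^2)$ for all $v\in\mathcal V$. $\mathcal V$ is a Hilbert space under an inner product $\langle\cdot,\cdot\rangle_{\mathcal V}$ equivalent to $\frac12\big(a(w,v)+\overline{a(v,w)}\big)$. $A$ is the (possibly unbounded) closed m-sectorial operator in $\mathcal H$ associated with $a$: $\mathrm{Dom}(A)=\{v\in\mathcal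 V: \exists\, m_v,\ |a(w,v)|\le m_v\|w\|_{\mathcal H}\ \forall w\in\mathcal V\}$ and $a(w,v)=\langle w,Av\rangle_{\mathcal H}$ for $v\in \mathrm{Dom}(A)$, $w\in\mathcal V$. $\lambda\ne0$ is an isolated eigenvalue of $A$ of finite algebraic multiplicity $m$, and $\mathcal U=\bigcup_{k\ge1}\mathrm{Ker}[(A-\lambda I)^k]$ is the associated $m$-dimensional maximal invariant subspace (the range of the spectral projection of $A$ for $\lambda$). For each $h>0$, $\mathcal S_{1,h},\mathcal S_{2,h}\subset\mathcal V$ are subspaces of the same finite dimension $N(h)$ satisfying $$\beta(h)=\inf_{u\in\mathcal S_{2,h},\|u\|_{\mathcal V}=1}\ \sup_{v\in\mathcal S_{1,h},\|v\|_{\mathcal V}=1}|a(u,v)|>0,\qquad \overset{\circ}{\beta}(h)=\inf_{u\in\mathcal S_{2,h},\|u\|_{\mathcal H}=1}\ \sup_{v\in\mathcal S_{1,h},\|v\|_{\mathcal H}=1}|\langle u,v\rangle_{\mathcal H}|>0.$$ $P_h:\mathcal V\to\mathcal S_{1,h}$ is the projection defined by $a(u,v-P_hv)=0$ for all $u\in\mathcal S_{2,h}$. $Q_h:\mathcal H\to\mathcal S_{1,h}$ is the projection defined by $\langle u,v-Q_hv\rangle_{\mathcal H}=0$ for all $u\in\mathcal S_{2,h}$. $A_h=Q_hAQ_h$ (with $A$ extended to a map $\mathcal V\to\mathcal V'$ and $Q_h$ extended naturally to $\mathcal V'$): for $v\in\mathcal S_{1,h}$, $A_hv$ is the unique element of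 $\mathcal S_{1,h}$ with $\langle u,A_hv\rangle_{\mathcal H}=a(u,v)$ for all $u\in\mathcal S_{2,h}$, and $A_h=A_hQ_h$ on $\mathcal H$. $\Pi_{1,h}$ is the $\mathcal H$-orthogonal projection onto $\mathcal S_{1,h}$. For closed subspaces $\mathcal M,\mathcal N$ of $\mathcal H$, $\delta_{\mathcal H}(\mathcal M,\mathcal N)=\sup_{0\ne x\in\mathcal M}\inf_{y\in\mathcal N}\|y-x\|_{\mathcal H}/\|x\|_{\mathcal H}$. For closed operators $L,B$ in $\mathcal H$, $\delta_{\mathcal H}(L,B)=\sup_{0\neq x\in \mathrm{Dom}(L)}\inf_{y\in \mathrm{Dom}(B)}\frac{\|x-y\|_{\mathcal H}+\|Lx-By\|_{\mathcal H}}{\|x\|_{\mathcal H}+\|Lx\|_{\mathcal H}}$. In $\delta_{\mathcal H}(A_h,A)$, the operator $A_h$ is regarded as having domain $\mathcal S_{1,h}$. Let $\Gamma$ be a circle in $\mathbb C$ centered at $\lambda$ with the origin and all points of $\sigma(A)$ other than $\lambda$ in its exterior. Under the two convergence hypotheses, for all sufficiently small $h$ exactly $m$ eigenvalues of $A_h$ (counting multiplicity) lie inside $\Gamma$ and none on $\Gamma$; $\mathcal U_h\subset \mathcal S_{1,h}$ denotes the $m$-dimensional $A_h$-invariant subspace associated with them, i.e. the range of $E_h=\frac1{2\pi i}\int_\Gamma(z-A_h)^{-1}dz$. Finally, $$\overset{\circ}{\varepsilon}_{\mathcal H}(h)=\sup_{u\in\mathcal U}\frac{\|(P_h-Q_h)u\|_{\mathcal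 H}}{\|(I-\Pi_{1,h})u\|_{\mathcal H}},$$ where quotients $0/0$ are read as $0$ (the numerator vanishes whenever the denominator does). *)

theory Defs
  imports "HOL-Analysis.Analysis" "HOL-Complex_Analysis.Complex_Analysis"
begin

section \<open>Complex Hilbert spaces\<close>

text \<open>
  The inner product is conjugate linear in the first argument.  The real scalar multiplication of
  the underlying real normed space is the restriction of the complex one.
\<close>

class complex_inner = real_normed_vector +
  fixes scaleC :: "complex \<Rightarrow> 'a \<Rightarrow> 'a" (infixr \<open>*\<^sub>C\<close> 75)
    and cinner :: "'a \<Rightarrow> 'a \<Rightarrow> complex"
  assumes scaleC_add_right: "c *\<^sub>C (x + y) = c *\<^sub>C x + c *\<^sub>C y"
    and scaleC_add_left: "(c + d) *\<^sub>C x = c *\<^sub>C x + d *\<^sub>C x"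
    and scaleC_scaleC: "c *\<^sub>C (d *\<^sub>C x) = (c * d) *\<^sub>C x"
    and scaleR_eq_scaleC: "scaleR r x = complex_of_real r *\<^sub>C x"
    and cinner_commute: "cinner x y = cnj (cinner y x)"
    and cinner_add_right: "cinner x (y + z) = cinner x y + cinner x z"
    and cinner_scaleC_right: "cinner x (c *\<^sub>C y) = c * cinner x y"
    and cinner_ge_zero: "0 \<le> Re (cinner x x)"
    and norm_eq_sqrt_cinner: "norm x = sqrt (Re (cinner x x))"

class chilbert_space = complex_inner + banach

instantiation complex :: chilbert_space
begin

definition scaleC_complex :: "complex \<Rightarrow> complex \<Rightarrow> complex"
  where "scaleC_complex c x = c * x"

definition cinner_complex :: "complex \<Rightarrow> complex \<Rightarrow> complex"
  where "cinner_complex x y = cnj x * y"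

instance
  by standard
    (auto simp: scaleC_complex_def cinner_complex_def algebra_simps scaleR_conv_of_real
      cmod_power2 norm_complex_def power2_eq_square)

end

global_interpretation cvs: vector_space "scaleC :: complex \<Rightarrow> 'a \<Rightarrow> 'a::complex_inner"
  by standard
    (simp_all add: scaleC_add_right scaleC_add_left scaleC_scaleC scaleR_eq_scaleC [symmetric, of 1, simplified])

definition has_cdim :: "'a::complex_inner set \<Rightarrow> nat \<Rightarrow> bool"
  where "has_cdim S n \<longleftrightarrow>
    (\<exists>B. finite B \<and> card B = n \<and> cvs.independent B \<and> cvs.span B = S)"


section \<open>Sesquilinear forms on a subspace\<close>

definition sesquilinear_on :: "'a::complex_inner set \<Rightarrow> ('a \<Rightarrow> 'a \<Rightarrow> complex) \<Rightarrow> bool"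
  where "sesquilinear_on V b \<longleftrightarrow>
    (\<forall>w\<in>V. \<forall>u\<in>V. \<forall>v\<in>V. b w (u + v) = b w u + b w v \<and> b (u + v) w = b u w + b v w) \<and>
    (\<forall>w\<in>V. \<forall>v\<in>V. \<forall>c. b w (c *\<^sub>C v) = c * b w v \<and> b (c *\<^sub>C w) v = cnj c * b w v)"

definition inner_product_on :: "'a::complex_inner set \<Rightarrow> ('a \<Rightarrow> 'a \<Rightarrow> complex) \<Rightarrow> bool"
  where "inner_product_on V b \<longleftrightarrow>
    sesquilinear_on V b \<and>
    (\<forall>w\<in>V. \<forall>v\<in>V. b w v = cnj (b v w)) \<and>
    (\<forall>v\<in>V. v \<noteq> 0 \<longrightarrow> 0 < Re (b v v))"

definition form_norm :: "('a::complex_inner \<Rightarrow> 'a \<Rightarrow> complex) \<Rightarrow> 'a \<Rightarrow> real"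
  where "form_norm b v = sqrt (Re (b v v))"

definition hilbert_on :: "'a::complex_inner set \<Rightarrow> ('a \<Rightarrow> 'a \<Rightarrow> complex) \<Rightarrow> bool"
  where "hilbert_on V b \<longleftrightarrow>
    cvs.subspace V \<and> inner_product_on V b \<and>
    (\<forall>X. (\<forall>n. X n \<in> V) \<longrightarrow>
         (\<forall>e>0. \<exists>N. \<forall>m\<ge>N. \<forall>n\<ge>N. form_norm b (X m - X n) < e) \<longrightarrow>
         (\<exists>x\<in>V. (\<lambda>n. form_norm b (X n - x)) \<longlonglongrightarrow> 0))"

definition equivalent_on ::
    "'a::complex_inner set \<Rightarrow> ('a \<Rightarrow> 'a \<Rightarrow> complex) \<Rightarrow> ('a \<Rightarrow> 'a \<Rightarrow> complex) \<Rightarrow> bool"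
  where "equivalent_on V b b' \<longleftrightarrow>
    (\<exists>c>0. \<exists>C>0. \<forall>v\<in>V. c * form_norm b' v \<le> form_norm b v \<and> form_norm b v \<le> C * form_norm b' v)"

definition real_part_form :: "('a::complex_inner \<Rightarrow> 'a \<Rightarrow> complex) \<Rightarrow> 'a \<Rightarrow> 'a \<Rightarrow> complex"
  where "real_part_form a w v = (a w v + cnj (a v w)) / 2"

text \<open>Closedness of a (sectorial) form in the sense of Kato.\<close>

definition closed_form :: "'a::complex_inner set \<Rightarrow> ('a \<Rightarrow> 'a \<Rightarrow> complex) \<Rightarrow> bool"
  where "closed_form V a \<longleftrightarrow>
    (\<forall>X x. (\<forall>n. X n \<in> V) \<longrightarrow> X \<longlonglongrightarrow> x \<longrightarrow>
       (\<forall>e>0. \<exists>N. \<forall>m\<ge>N. \<forall>n\<ge>N. cmod (a (X m - X n) (X m - X n)) < e) \<longrightarrow>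
       x \<in> V \<and> (\<lambda>n. a (X n - x) (X n - x)) \<longlonglongrightarrow> 0)"

definition sectorial_form ::
    "'a::complex_inner set \<Rightarrow> ('a \<Rightarrow> 'a \<Rightarrow> complex) \<Rightarrow> real \<Rightarrow> real \<Rightarrow> bool"
  where "sectorial_form V a \<alpha> M \<longleftrightarrow>
    (\<forall>v\<in>V. \<alpha> * (norm v)\<^sup>2 \<le> Re (a v v) \<and>
           \<bar>Im (a v v)\<bar> \<le> M * (Re (a v v) - \<alpha> * (norm v)\<^sup>2))"


section \<open>Unbounded operators\<close>

text \<open>
  An operator is a pair of a domain and a function; the values of the function off the domain
  carry no information.
\<close>

definition form_dom :: "'a::complex_inner set \<Rightarrow> ('a \<Rightarrow> 'a \<Rightarrow> complex) \<Rightarrow> 'a set"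
  where "form_dom V a = {v \<in> V. \<exists>m. \<forall>w\<in>V. cmod (a w v) \<le> m * norm w}"

text \<open>For \<open>v \<in> form_dom V a\<close> the vector below exists by the Riesz theorem, and it is unique
  because the form domain is dense.\<close>

definition form_op :: "'a::complex_inner set \<Rightarrow> ('a \<Rightarrow> 'a \<Rightarrow> complex) \<Rightarrow> 'a \<Rightarrow> 'a"
  where "form_op V a v = (THE f. \<forall>w\<in>V. a w v = cinner w f)"

definition resolvent_set :: "'a::complex_inner set \<Rightarrow> ('a \<Rightarrow> 'a) \<Rightarrow> complex set"
  where "resolvent_set D L =
    {z. bij_betw (\<lambda>x. z *\<^sub>C x - L x) D UNIV \<and>
        (\<exists>K. \<forall>x\<in>D. norm x \<le> K * norm (z *\<^sub>C x - L x))}"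

definition spectrum :: "'a::complex_inner set \<Rightarrow> ('a \<Rightarrow> 'a) \<Rightarrow> complex set"
  where "spectrum D L = - resolvent_set D L"

definition resolvent :: "'a::complex_inner set \<Rightarrow> ('a \<Rightarrow> 'a) \<Rightarrow> complex \<Rightarrow> 'a \<Rightarrow> 'a"
  where "resolvent D L z = inv_into D (\<lambda>x. z *\<^sub>C x - L x)"

text \<open>\<open>(1 / (2 \<pi> \<i>)) \<integral> (z - L)\<inverse> x dz\<close> over the positively oriented circle
  of radius \<open>r\<close> about \<open>c\<close>.  The library's contour integral is
  restricted to complex-valued integrands, so its defining integral is written out for integrands
  with values in the space.\<close>

definition riesz_projection ::
    "'a::chilbert_space set \<Rightarrow> ('a \<Rightarrow> 'a) \<Rightarrow> complex \<Rightarrow> real \<Rightarrow> 'a \<Rightarrow> 'a"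
  where "riesz_projection D L c r x =
    (1 / (2 * complex_of_real pi * \<i>)) *\<^sub>C
      integral {0..1}
        (\<lambda>t. vector_derivative (circlepath c r) (at t within {0..1}) *\<^sub>C
             resolvent D L (circlepath c r t) x)"

definition eigenvalue :: "'a::complex_inner set \<Rightarrow> ('a \<Rightarrow> 'a) \<Rightarrow> complex \<Rightarrow> bool"
  where "eigenvalue D L z \<longleftrightarrow> (\<exists>v\<in>D. v \<noteq> 0 \<and> L v = z *\<^sub>C v)"

primrec pow_dom :: "'a set \<Rightarrow> ('a \<Rightarrow> 'a) \<Rightarrow> nat \<Rightarrow> 'a set"
  where
    "pow_dom D L 0 = UNIV"
  | "pow_dom D L (Suc k) = {v \<in> D. L v \<in> pow_dom D L k}"

definition pow_ker :: "'a::complex_inner set \<Rightarrow> ('a \<Rightarrow> 'a) \<Rightarrow> nat \<Rightarrow> 'a set"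
  where "pow_ker D L k = {v \<in> pow_dom D L k. (L ^^ k) v = 0}"

definition gen_eigenspace :: "'a::complex_inner set \<Rightarrow> ('a \<Rightarrow> 'a) \<Rightarrow> complex \<Rightarrow> 'a set"
  where "gen_eigenspace D L z = (\<Union>k\<in>{1..}. pow_ker D (\<lambda>v. L v - z *\<^sub>C v) k)"


section \<open>Gaps\<close>

text \<open>
  Infima and suprema of nonnegative quantities are taken in \<^typ>\<open>ennreal\<close>, so that they always
  exist, with \<open>sup {} = 0\<close> and \<open>inf {} = \<infinity>\<close>.
\<close>

definition subspace_gap :: "'a::complex_inner set \<Rightarrow> 'a set \<Rightarrow> ennreal"
  where "subspace_gap M N = (SUP x\<in>M - {0}. INF y\<in>N. ennreal (norm (y - x) / norm x))"

definition operator_gap ::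
    "'a::complex_inner set \<Rightarrow> ('a \<Rightarrow> 'a) \<Rightarrow> 'a set \<Rightarrow> ('a \<Rightarrow> 'a) \<Rightarrow> ennreal"
  where "operator_gap D L D' B =
    (SUP x\<in>D - {0}. INF y\<in>D'.
       ennreal ((norm (x - y) + norm (L x - B y)) / (norm x + norm (L x))))"


section \<open>Petrov--Galerkin approximation\<close>

text \<open>\<open>S1\<close> is the trial space and \<open>S2\<close> the test space.\<close>

definition inf_sup ::
    "('a::complex_inner \<Rightarrow> real) \<Rightarrow> ('a \<Rightarrow> 'a \<Rightarrow> complex) \<Rightarrow> 'a set \<Rightarrow> 'a set \<Rightarrow> ennreal"
  where "inf_sup nrm b S1 S2 =
    (INF u\<in>{u \<in> S2. nrm u = 1}. SUP v\<in>{v \<in> S1. nrm v = 1}. ennreal (cmod (b u v)))"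

text \<open>Existence and uniqueness of the vectors below follow from \<open>dim S1 = dim S2 < \<infinity>\<close>
  together with positivity of the corresponding inf-sup constant.\<close>

definition galerkin_proj ::
    "('a::complex_inner \<Rightarrow> 'a \<Rightarrow> complex) \<Rightarrow> 'a set \<Rightarrow> 'a set \<Rightarrow> 'a \<Rightarrow> 'a"
  where "galerkin_proj b S1 S2 v = (THE p. p \<in> S1 \<and> (\<forall>u\<in>S2. b u (v - p) = 0))"

abbreviation orth_proj :: "'a::complex_inner set \<Rightarrow> 'a \<Rightarrow> 'a"
  where "orth_proj S \<equiv> galerkin_proj cinner S S"

text \<open>The discrete operator on the whole space: the operator on \<open>S1\<close> determined by the form,
  composed with the projection associated with the inner product.\<close>

definition galerkin_op ::
    "('a::complex_inner \<Rightarrow> 'a \<Rightarrow> complex) \<Rightarrow> 'a set \<Rightarrow> 'a set \<Rightarrow> 'a \<Rightarrow> 'a"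
  where "galerkin_op a S1 S2 x =
    (THE y. y \<in> S1 \<and> (\<forall>u\<in>S2. cinner u y = a u (galerkin_proj cinner S1 S2 x)))"

text \<open>The quotient uses \<open>0 / 0 = 0\<close>; for \<open>u \<in> S1 \<inter> Dom a\<close> both differences vanish, so no other
  division by zero occurs.\<close>

definition proj_ratio ::
    "('a::complex_inner \<Rightarrow> 'a \<Rightarrow> complex) \<Rightarrow> 'a set \<Rightarrow> 'a set \<Rightarrow> 'a set \<Rightarrow> ennreal"
  where "proj_ratio a S1 S2 U =
    (SUP u\<in>U. ennreal (norm (galerkin_proj a S1 S2 u - galerkin_proj cinner S1 S2 u) /
                       norm (u - orth_proj S1 u)))"

end

theory Submission
  imports Defs
begin

text \<open>
  The discrete vector is \<open>u\<^sub>h = E\<^sub>h Q\<^sub>h u\<close>, the discrete spectral projection of the projected eigenvector.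
  For \<open>u\<close> in the invariant subspace \<open>U\<close> and \<open>z\<close> on the circle put \<open>w(z) = (z - A)\<inverse> u\<close>, again an element of
  \<open>U\<close>.  Since \<open>A - \<lambda>\<close> is nilpotent on \<open>u\<close>, this resolvent is a finite Neumann sum
  (\<open>resolvent_sum_telescopes\<close>), and integrating term by term shows that \<open>Q\<^sub>h u\<close> is the normalized
  integral of \<open>Q\<^sub>h w(z)\<close>.  The vector \<open>E\<^sub>h Q\<^sub>h u\<close> is the normalized integral of \<open>(z - A\<^sub>h)\<inverse> Q\<^sub>h u\<close>.  So it
  suffices to compare the integrands, uniformly on the circle.

  The two Galerkin projections satisfy \<open>A\<^sub>h P\<^sub>h w = Q\<^sub>h A w\<close> on the domain of \<open>A\<close>, which gives
  \<open>(z - A\<^sub>h) (Q\<^sub>h w - (z - A\<^sub>h)\<inverse> Q\<^sub>h u) = A\<^sub>h e\<close> with \<open>e = (P\<^sub>h - Q\<^sub>h) w\<close>.  As \<open>(z - A\<^sub>h)\<inverse> A\<^sub>h = z (z - A\<^sub>h)\<inverse> - 1\<close>,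
  a bound \<open>C\<close> for the discrete resolvent bounds the difference of the integrands by \<open>(C \<bar>z\<bar> + 1) \<parallel>e\<parallel>\<close>
  (\<open>norm_resolvent_Ah_diff_le\<close>), although the norms of \<open>A\<^sub>h\<close> themselves may be unbounded.  By definition
  of the ratio of projections and of the gap, \<open>\<parallel>e\<parallel>\<close> is at most their product times \<open>\<parallel>w(z)\<parallel>\<close>
  (\<open>norm_P_diff_Q_le\<close>), and \<open>\<parallel>w(z)\<parallel>\<close> is at most a constant times \<open>\<parallel>u\<parallel>\<close>.

  The constant is independent of \<open>h\<close> because the discrete resolvents are uniformly bounded: the
  resolvent of \<open>A\<close> is bounded on the circle by compactness (\<open>resolvent_bound_compact\<close>), and convergence
  of the operator gap transfers this bound to \<open>A\<^sub>h\<close> for small \<open>h\<close> (\<open>resolvent_bound_operator_gap\<close>).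

  Two existence results give the definite descriptions their meaning: unique solvability of
  Petrov--Galerkin problems by counting dimensions (\<open>ex1_representing\<close>), and the Riesz theorem for
  functionals that are defined and bounded on a subspace (\<open>riesz_representation_on_subspace\<close>).
\<close>

section \<open>Complex inner products and linear maps on subspaces\<close>

lemma cinner_add_left: "cinner (x + y) z = cinner x z + cinner y z"
  by (metis cinner_add_right cinner_commute complex_cnj_add)

lemma cinner_scaleC_left: "cinner (c *\<^sub>C x) y = cnj c * cinner x y"
  by (metis cinner_scaleC_right cinner_commute complex_cnj_mult)

lemma sesquilinear_cinner: "sesquilinear_on UNIV cinner"
  unfolding sesquilinear_on_def
  by (simp add: cinner_add_left cinner_add_right cinner_scaleC_left cinner_scaleC_right)

lemma power2_norm_eq_cinner: "(norm x)\<^sup>2 = Re (cinner x x)"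
  using cinner_ge_zero[of x] by (simp add: norm_eq_sqrt_cinner)

lemma Re_cinner_commute: "Re (cinner x y) = Re (cinner y x)"
  by (subst cinner_commute) simp

lemma norm_add_squared: "(norm (x + y))\<^sup>2 = (norm x)\<^sup>2 + 2 * Re (cinner x y) + (norm y)\<^sup>2"
  unfolding power2_norm_eq_cinner cinner_add_left cinner_add_right
  using Re_cinner_commute[of x y] by simp

lemma form_norm_scaleC:
  assumes "sesquilinear_on V b" "v \<in> V" "cvs.subspace V"
  shows "form_norm b (c *\<^sub>C v) = cmod c * form_norm b v"
proof -
  have "b (c *\<^sub>C v) (c *\<^sub>C v) = (c * cnj c) * b v v"
    using assms cvs.subspace_scale[OF assms(3,2)] unfolding sesquilinear_on_def by simp
  also have "c * cnj c = complex_of_real ((cmod c)\<^sup>2)"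
    by (rule complex_norm_square[symmetric])
  finally have "Re (b (c *\<^sub>C v) (c *\<^sub>C v)) = (cmod c)\<^sup>2 * Re (b v v)"
    by simp
  then show ?thesis by (simp add: form_norm_def real_sqrt_mult)
qed

lemma norm_scaleC: "norm (c *\<^sub>C x) = cmod c * norm (x :: 'a::complex_inner)"
  using form_norm_scaleC[OF sesquilinear_cinner, of x c]
  by (simp add: form_norm_def norm_eq_sqrt_cinner)

lemma scaleC_scaleR: "c *\<^sub>C (s *\<^sub>R x) = s *\<^sub>R (c *\<^sub>C (x :: 'a::complex_inner))"
  by (simp add: scaleR_eq_scaleC scaleC_scaleC mult.commute)

lemma scaleR_scaleC: "(s *\<^sub>R c) *\<^sub>C x = s *\<^sub>R (c *\<^sub>C (x :: 'a::complex_inner))"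
  by (simp add: scaleR_eq_scaleC scaleC_scaleC scaleC_complex_def)

lemma bounded_bilinear_scaleC: "bounded_bilinear ((*\<^sub>C) :: complex \<Rightarrow> 'a \<Rightarrow> 'a::complex_inner)"
  by standard
    (auto simp: scaleC_add_left scaleC_add_right scaleC_scaleR scaleR_scaleC norm_scaleC
      intro!: exI[of _ 1])

definition clinear_on :: "'a::complex_inner set \<Rightarrow> ('a \<Rightarrow> 'b::complex_inner) \<Rightarrow> bool"
  where "clinear_on S T \<longleftrightarrow>
    (\<forall>x\<in>S. \<forall>y\<in>S. T (x + y) = T x + T y) \<and> (\<forall>x\<in>S. \<forall>c. T (c *\<^sub>C x) = c *\<^sub>C T x)"

lemma clinear_onI:
  assumes "\<And>x y. x \<in> S \<Longrightarrow> y \<in> S \<Longrightarrow> T (x + y) = T x + T y"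
    and "\<And>x c. x \<in> S \<Longrightarrow> T (c *\<^sub>C x) = c *\<^sub>C T x"
  shows "clinear_on S T"
  using assms by (simp add: clinear_on_def)

lemma clinear_on_add: "clinear_on S T \<Longrightarrow> x \<in> S \<Longrightarrow> y \<in> S \<Longrightarrow> T (x + y) = T x + T y"
  by (simp add: clinear_on_def)

lemma clinear_on_scaleC: "clinear_on S T \<Longrightarrow> x \<in> S \<Longrightarrow> T (c *\<^sub>C x) = c *\<^sub>C T x"
  by (simp add: clinear_on_def)

lemma clinear_on_subset: "clinear_on S T \<Longrightarrow> S' \<subseteq> S \<Longrightarrow> clinear_on S' T"
  unfolding clinear_on_def by blast

lemma clinear_on_zero:
  assumes "clinear_on S T" "cvs.subspace S" shows "T 0 = 0"
  using clinear_on_scaleC[OF assms(1), of 0 0] cvs.subspace_0[OF assms(2)] by simp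

lemma clinear_on_diff:
  assumes "clinear_on S T" "cvs.subspace S" "x \<in> S" "y \<in> S"
  shows "T (x - y) = T x - T y"
  using clinear_on_add[OF assms(1), of "x - y" y] cvs.subspace_diff[OF assms(2-4)] assms(4)
  by (simp add: algebra_simps)

lemma clinear_on_sum:
  assumes "clinear_on S T" "cvs.subspace S" "\<And>i. i \<in> I \<Longrightarrow> x i \<in> S"
  shows "T (\<Sum>i\<in>I. c i *\<^sub>C x i) = (\<Sum>i\<in>I. c i *\<^sub>C T (x i))"
  using assms(3)
proof (induction I rule: infinite_finite_induct)
  case (insert j I)
  have "(\<Sum>i\<in>I. c i *\<^sub>C x i) \<in> S"
    using insert.prems by (intro cvs.subspace_sum cvs.subspace_scale assms(2)) auto
  then show ?case
    using insert cvs.subspace_scale[OF assms(2), of "x j" "c j"]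
    by (simp add: clinear_on_add[OF assms(1)] clinear_on_scaleC[OF assms(1)])
qed (simp_all add: clinear_on_zero[OF assms(1,2)])

lemma clinear_on_shift:
  assumes "clinear_on S L"
  shows "clinear_on S (\<lambda>x. z *\<^sub>C x - L x)"
  by (rule clinear_onI)
    (simp_all add: clinear_on_add[OF assms] clinear_on_scaleC[OF assms] algebra_simps)

lemma has_cdim_subspace: "has_cdim S n \<Longrightarrow> cvs.subspace S"
  by (auto simp: has_cdim_def)

text \<open>
  The dimension count behind all the finite-dimensional problems below: an injective map carries a
  basis of \<open>S\<close> to \<open>n\<close> independent vectors of \<open>S'\<close>, and by the exchange lemma these span it.  The map is
  required to be linear on \<open>S\<close> only, as the forms are sesquilinear on the form domain only.
\<close>

lemma injective_surjective_of_equal_cdim: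
  assumes S: "has_cdim S n" and S': "has_cdim S' n"
    and T: "clinear_on S T" and into: "T ` S \<subseteq> S'"
    and inj: "\<And>x. x \<in> S \<Longrightarrow> T x = 0 \<Longrightarrow> x = 0"
  shows "T ` S = S'"
proof -
  obtain B where B: "finite B" "card B = n" "cvs.independent B" "cvs.span B = S"
    using S by (auto simp: has_cdim_def)
  obtain B' where B': "finite B'" "card B' = n" "cvs.independent B'" "cvs.span B' = S'"
    using S' by (auto simp: has_cdim_def)
  note sub = has_cdim_subspace[OF S]
  have BS: "B \<subseteq> S" using B(4) cvs.span_superset by blast
  have injT: "inj_on T S"
  proof (rule inj_onI)
    fix x y assume "x \<in> S" "y \<in> S" "T x = T y"
    then show "x = y"
      using inj[of "x - y"] clinear_on_diff[OF T sub] cvs.subspace_diff[OF sub] by simp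
  qed
  have injB: "inj_on T B" using inj_on_subset[OF injT BS] .
  have sumT: "T (\<Sum>e\<in>B. f e *\<^sub>C e) = (\<Sum>e\<in>B. f e *\<^sub>C T e)" for f
    using clinear_on_sum[OF T sub, of B "\<lambda>e. e" f] BS by auto
  have ind: "cvs.independent (T ` B)"
  proof (rule cvs.independent_if_scalars_zero)
    fix f y assume f: "(\<Sum>y\<in>T ` B. f y *\<^sub>C y) = 0" and "y \<in> T ` B"
    then obtain e where e: "e \<in> B" "y = T e" by blast
    have "T (\<Sum>e\<in>B. f (T e) *\<^sub>C e) = 0"
      using f by (simp add: sum.reindex[OF injB] sumT)
    then have "(\<Sum>e\<in>B. f (T e) *\<^sub>C e) = 0"
      using BS by (intro inj cvs.subspace_sum cvs.subspace_scale sub) auto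
    then show "f y = 0"
      using cvs.independentD[OF B(3,1) order_refl, of "\<lambda>e. f (T e)" e] e by simp
  qed (simp add: B(1))
  have "S' \<subseteq> T ` S"
  proof
    fix y assume y: "y \<in> S'"
    have "y \<in> cvs.span (T ` B)"
    proof (rule ccontr)
      assume n: "y \<notin> cvs.span (T ` B)"
      then have "cvs.independent (insert y (T ` B))" using ind cvs.independent_insertI by blast
      moreover have "insert y (T ` B) \<subseteq> cvs.span B'" using y into BS B'(4) by auto
      ultimately have "card (insert y (T ` B)) \<le> n"
        using cvs.independent_span_bound[OF B'(1)] B'(2) by blast
      moreover have "card (insert y (T ` B)) = Suc n"
        using n B(1,2) cvs.span_base[of y "T ` B"] by (subst card_insert_disjoint) (auto simp: card_image[OF injB])
      ultimately show False by simp
    qed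
    then obtain f where "y = (\<Sum>z\<in>T ` B. f z *\<^sub>C z)"
      using cvs.span_finite[of "T ` B"] B(1) by auto
    then have "y = T (\<Sum>e\<in>B. f (T e) *\<^sub>C e)" by (simp add: sum.reindex[OF injB] sumT)
    moreover have "(\<Sum>e\<in>B. f (T e) *\<^sub>C e) \<in> S"
      using BS by (intro cvs.subspace_sum cvs.subspace_scale sub) auto
    ultimately show "y \<in> T ` S" by blast
  qed
  with into show ?thesis by blast
qed

section \<open>Petrov--Galerkin problems\<close>

lemma sesquilinear_on_right:
  "sesquilinear_on V b \<Longrightarrow> w \<in> V \<Longrightarrow> clinear_on V (b w)"
  by (simp add: sesquilinear_on_def clinear_on_def scaleC_complex_def)

text \<open>
  Positivity of an inf-sup constant enters only as nondegeneracy in the test variable, so that one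
  locale serves both the form with its own norm and the inner product with the norm of the space.
\<close>

locale petrov_galerkin =
  fixes V :: "'a::complex_inner set" and b :: "'a \<Rightarrow> 'a \<Rightarrow> complex" and S1 S2 :: "'a set"
    and n :: nat
  assumes V: "cvs.subspace V" and b: "sesquilinear_on V b"
    and S1V: "S1 \<subseteq> V" and S2V: "S2 \<subseteq> V"
    and S1: "has_cdim S1 n" and S2: "has_cdim S2 n"
    and left_nondegenerate: "\<And>u. u \<in> S2 \<Longrightarrow> (\<And>v. v \<in> S1 \<Longrightarrow> b u v = 0) \<Longrightarrow> u = 0"
begin

lemma left_add: "u \<in> V \<Longrightarrow> v \<in> V \<Longrightarrow> w \<in> V \<Longrightarrow> b (u + v) w = b u w + b v w"
  and left_scaleC: "u \<in> V \<Longrightarrow> w \<in> V \<Longrightarrow> b (c *\<^sub>C u) w = cnj c * b u w"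
  and right_add: "u \<in> V \<Longrightarrow> v \<in> V \<Longrightarrow> w \<in> V \<Longrightarrow> b w (u + v) = b w u + b w v"
  and right_scaleC: "u \<in> V \<Longrightarrow> w \<in> V \<Longrightarrow> b w (c *\<^sub>C u) = c * b w u"
  using b by (auto simp: sesquilinear_on_def)

lemma right_diff: "w \<in> V \<Longrightarrow> u \<in> V \<Longrightarrow> v \<in> V \<Longrightarrow> b w (u - v) = b w u - b w v"
  using clinear_on_diff[OF sesquilinear_on_right[OF b] V] by blast

text \<open>
  Equality of dimensions moves nondegeneracy from the test to the trial variable.  The linear map
  \<open>T\<close>, which takes \<open>u\<close> to the sum of \<open>cnj (b u f)\<close> times \<open>f\<close> over a basis of the trial space, is injective
  by left nondegeneracy, hence onto.  Writing \<open>p = T u\<close> turns \<open>b u p\<close> into a sum of squared moduli.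
\<close>

lemma right_nondegenerate:
  assumes p: "p \<in> S1" and 0: "\<And>u. u \<in> S2 \<Longrightarrow> b u p = 0"
  shows "p = 0"
proof -
  obtain B where B: "finite B" "card B = n" "cvs.independent B" "cvs.span B = S1"
    using S1 by (auto simp: has_cdim_def)
  have BS: "B \<subseteq> S1" using B(4) cvs.span_superset by blast
  define T where "T u = (\<Sum>f\<in>B. cnj (b u f) *\<^sub>C f)" for u
  have "T ` S2 = S1"
  proof (rule injective_surjective_of_equal_cdim[OF S2 S1])
    show "clinear_on S2 T"
    proof (rule clinear_onI)
      fix x y assume "x \<in> S2" "y \<in> S2"
      then show "T (x + y) = T x + T y" using BS S1V S2V unfolding T_def sum.distrib[symmetric]
        by (intro sum.cong refl) (simp add: subset_iff left_add scaleC_add_left)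
    next
      fix x c assume "x \<in> S2"
      then show "T (c *\<^sub>C x) = c *\<^sub>C T x" using BS S1V S2V unfolding T_def cvs.scale_sum_right
        by (intro sum.cong refl) (simp add: subset_iff left_scaleC)
    qed
    show "T ` S2 \<subseteq> S1" unfolding T_def using BS
      by (auto intro!: cvs.subspace_sum cvs.subspace_scale has_cdim_subspace[OF S1])
    fix x assume x: "x \<in> S2" "T x = 0"
    then have z: "b x f = 0" if "f \<in> B" for f
      using cvs.independentD[OF B(3,1) order_refl, of "\<lambda>f. cnj (b x f)" f] that by (simp add: T_def)
    show "x = 0"
    proof (rule left_nondegenerate[OF x(1)])
      fix v assume "v \<in> S1"
      then obtain c where v: "v = (\<Sum>f\<in>B. c f *\<^sub>C f)" using cvs.span_finite[OF B(1)] B(4) by auto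
      have "b x v = (\<Sum>f\<in>B. c f *\<^sub>C b x f)" unfolding v
        using BS S1V S2V x(1) by (intro clinear_on_sum[OF sesquilinear_on_right[OF b] V]) auto
      then show "b x v = 0" using z by simp
    qed
  qed
  then obtain u where u: "u \<in> S2" "p = T u" using p by blast
  have "b u p = (\<Sum>f\<in>B. cnj (b u f) *\<^sub>C b u f)" unfolding u(2) T_def
    using BS S1V S2V u(1) by (intro clinear_on_sum[OF sesquilinear_on_right[OF b] V]) auto
  also have "\<dots> = complex_of_real (\<Sum>f\<in>B. (cmod (b u f))\<^sup>2)"
    unfolding of_real_sum complex_norm_square scaleC_complex_def by (simp add: mult.commute)
  finally have "(\<Sum>f\<in>B. (cmod (b u f))\<^sup>2) = 0" using 0[OF u(1)] by (metis of_real_eq_0_iff)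
  then have "\<forall>f\<in>B. b u f = 0" by (simp add: sum_nonneg_eq_0_iff[OF B(1)])
  then show ?thesis by (simp add: u(2) T_def)
qed

text \<open>
  The discrete form of the Riesz theorem, used for both projections and for the discrete operator.
  Testing against a basis of \<open>S2\<close> is an injective linear map \<open>S1 \<rightarrow> S2\<close>, hence onto.
\<close>

lemma ex1_representing:
  assumes add: "\<And>u v. u \<in> S2 \<Longrightarrow> v \<in> S2 \<Longrightarrow> F (u + v) = F u + F v"
    and scale: "\<And>u c. u \<in> S2 \<Longrightarrow> F (c *\<^sub>C u) = cnj c * F u"
  shows "\<exists>!p. p \<in> S1 \<and> (\<forall>u\<in>S2. b u p = F u)"
proof (rule ex_ex1I)
  obtain B where B: "finite B" "card B = n" "cvs.independent B" "cvs.span B = S2"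
    using S2 by (auto simp: has_cdim_def)
  have BS: "B \<subseteq> S2" using B(4) cvs.span_superset by blast
  have F0: "F 0 = 0" using scale[of 0 0] cvs.subspace_0[OF has_cdim_subspace[OF S2]] by simp
  have b0: "b 0 p = 0" if "p \<in> V" for p
    using left_scaleC[of 0 p 0] cvs.subspace_0[OF V] that by simp
  \<comment> \<open>Both sides are conjugate linear in the test vector, so a basis suffices.\<close>
  have agree: "b u p = G u" if "p \<in> S1" "u \<in> S2" "\<And>e. e \<in> B \<Longrightarrow> b e p = G e" "G 0 = 0"
    "\<And>u v. u \<in> S2 \<Longrightarrow> v \<in> S2 \<Longrightarrow> G (u + v) = G u + G v"
    "\<And>u c. u \<in> S2 \<Longrightarrow> G (c *\<^sub>C u) = cnj c * G u" for p u G
  proof -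
    have "u \<in> S2 \<and> b u p = G u"
      using that(2)[folded B(4)]
    proof (induction rule: cvs.span_induct_alt)
      case base show ?case
        using b0 that S1V cvs.subspace_0[OF has_cdim_subspace[OF S2]] by auto
    next
      case (step c x y)
      then have "x \<in> S2" "c *\<^sub>C x \<in> S2"
        using BS cvs.subspace_scale[OF has_cdim_subspace[OF S2]] by auto
      moreover from this step have "c *\<^sub>C x + y \<in> S2"
        using cvs.subspace_add[OF has_cdim_subspace[OF S2]] by blast
      ultimately show ?case using step that S1V S2V by (simp add: subset_iff left_add left_scaleC)
    qed
    then show ?thesis by blast
  qed
  define T where "T p = (\<Sum>e\<in>B. b e p *\<^sub>C e)" for p
  have "T ` S1 = S2"
  proof (rule injective_surjective_of_equal_cdim[OF S1 S2])
    show "clinear_on S1 T"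
    proof (rule clinear_onI)
      fix x y assume "x \<in> S1" "y \<in> S1"
      then show "T (x + y) = T x + T y" using BS S1V S2V unfolding T_def sum.distrib[symmetric]
        by (intro sum.cong refl) (simp add: subset_iff right_add scaleC_add_left)
    next
      fix x c assume "x \<in> S1"
      then show "T (c *\<^sub>C x) = c *\<^sub>C T x" using BS S1V S2V unfolding T_def cvs.scale_sum_right
        by (intro sum.cong refl) (simp add: subset_iff right_scaleC)
    qed
    show "T ` S1 \<subseteq> S2" unfolding T_def using BS
      by (auto intro!: cvs.subspace_sum cvs.subspace_scale has_cdim_subspace[OF S2])
    fix x assume x: "x \<in> S1" "T x = 0"
    then have z: "b e x = 0" if "e \<in> B" for e
      using cvs.independentD[OF B(3,1) order_refl, of "\<lambda>e. b e x" e] that by (simp add: T_def)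
    have "b u x = 0" if "u \<in> S2" for u
      using agree[OF x(1) that, of "\<lambda>_. 0"] z by simp
    then show "x = 0" using right_nondegenerate[OF x(1)] by blast
  qed
  moreover have "(\<Sum>e\<in>B. F e *\<^sub>C e) \<in> S2" using BS
      by (auto intro!: cvs.subspace_sum cvs.subspace_scale has_cdim_subspace[OF S2])
  ultimately obtain p where p: "p \<in> S1" "(\<Sum>e\<in>B. F e *\<^sub>C e) = T p" by blast
  have "(\<Sum>e\<in>B. (b e p - F e) *\<^sub>C e) = 0"
    using p(2) by (simp add: T_def cvs.scale_left_diff_distrib sum_subtractf)
  then have "b e p = F e" if "e \<in> B" for e
    using cvs.independentD[OF B(3,1) order_refl, of "\<lambda>e. b e p - F e" e] that by simp
  then have "\<forall>u\<in>S2. b u p = F u" using agree[OF p(1), of _ F] add scale F0 by blast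
  with p(1) show "\<exists>p. p \<in> S1 \<and> (\<forall>u\<in>S2. b u p = F u)" by blast
next
  fix p q assume "p \<in> S1 \<and> (\<forall>u\<in>S2. b u p = F u)" "q \<in> S1 \<and> (\<forall>u\<in>S2. b u q = F u)"
  moreover from this have "b u (p - q) = 0" if "u \<in> S2" for u
    using right_diff that S1V S2V by (simp add: subset_iff)
  ultimately show "p = q"
    using right_nondegenerate[of "p - q"] cvs.subspace_diff[OF has_cdim_subspace[OF S1]] by auto
qed

abbreviation "proj \<equiv> galerkin_proj b S1 S2"

lemma ex1_proj:
  assumes "x \<in> V" shows "\<exists>!p. p \<in> S1 \<and> (\<forall>u\<in>S2. b u p = b u x)"
  using assms S2V by (intro ex1_representing) (auto simp: subset_iff left_add left_scaleC)

lemma proj_eq_The: "x \<in> V \<Longrightarrow> proj x = (THE p. p \<in> S1 \<and> (\<forall>u\<in>S2. b u p = b u x))"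
  unfolding galerkin_proj_def using S1V S2V
  by (intro arg_cong[where f = The] ext) (auto simp: subset_iff right_diff)

lemma proj: "x \<in> V \<Longrightarrow> proj x \<in> S1" "x \<in> V \<Longrightarrow> u \<in> S2 \<Longrightarrow> b u (proj x) = b u x"
  using theI'[OF ex1_proj[of x]] by (auto simp: proj_eq_The)

lemma proj_unique:
  "x \<in> V \<Longrightarrow> p \<in> S1 \<Longrightarrow> (\<And>u. u \<in> S2 \<Longrightarrow> b u p = b u x) \<Longrightarrow> proj x = p"
  using ex1_proj[of x] proj[of x] by blast

lemma proj_id: "x \<in> S1 \<Longrightarrow> proj x = x"
  using S1V by (intro proj_unique) auto

lemma clinear_on_proj: "clinear_on V proj"
proof (rule clinear_onI)
  have S1s: "cvs.subspace S1" by (rule has_cdim_subspace[OF S1])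
  have "x \<in> V" if "x \<in> S1 \<union> S2" for x using that S1V S2V by blast
  note * = this
  fix x y assume "x \<in> V" "y \<in> V"
  then show "proj (x + y) = proj x + proj y"
    using cvs.subspace_add[OF S1s] cvs.subspace_add[OF V] proj *
    by (intro proj_unique) (auto simp: right_add)
next
  have S1s: "cvs.subspace S1" by (rule has_cdim_subspace[OF S1])
  have "x \<in> V" if "x \<in> S1 \<union> S2" for x using that S1V S2V by blast
  note * = this
  fix x c assume "x \<in> V"
  then show "proj (c *\<^sub>C x) = c *\<^sub>C proj x"
    using cvs.subspace_scale[OF S1s] cvs.subspace_scale[OF V] proj *
    by (intro proj_unique) (auto simp: right_scaleC)
qed

end

lemma petrov_galerkin_inf_sup:
  assumes "cvs.subspace V" "sesquilinear_on V b" "S1 \<subseteq> V" "S2 \<subseteq> V"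
    and "has_cdim S1 n" "has_cdim S2 n"
    and pos: "0 < inf_sup nrm b S1 S2"
    and nrm: "\<And>u. u \<in> S2 \<Longrightarrow> u \<noteq> 0 \<Longrightarrow> 0 < nrm u"
    and nrm_scale: "\<And>u c. u \<in> S2 \<Longrightarrow> nrm (c *\<^sub>C u) = cmod c * nrm u"
  shows "petrov_galerkin V b S1 S2 n"
proof
  fix u assume u: "u \<in> S2" and 0: "\<And>v. v \<in> S1 \<Longrightarrow> b u v = 0"
  show "u = 0"
  proof (rule ccontr)
    assume "u \<noteq> 0"
    then have n: "0 < nrm u" using nrm u by blast
    define w where "w = complex_of_real (inverse (nrm u)) *\<^sub>C u"
    have w: "w \<in> S2" "nrm w = 1"
      using n u cvs.subspace_scale[OF has_cdim_subspace[OF assms(6)]] nrm_scale[OF u]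
      by (simp_all add: w_def norm_inverse del: of_real_inverse)
    have "b w v = 0" if "v \<in> S1" for v
      using assms(2-4) u 0[OF that] that unfolding w_def sesquilinear_on_def by (simp add: subset_iff)
    then have "(SUP v\<in>{v \<in> S1. nrm v = 1}. ennreal (cmod (b w v))) = 0"
      by (intro antisym SUP_least) auto
    then have "inf_sup nrm b S1 S2 \<le> 0"
      unfolding inf_sup_def using w by (intro INF_lower2[of w]) auto
    with pos show False by simp
  qed
qed (use assms in auto)

lemma petrov_galerkin_orthogonal:
  assumes "has_cdim S n"
  shows "petrov_galerkin UNIV cinner S S n"
proof
  fix u assume "u \<in> S" and "\<And>v. v \<in> S \<Longrightarrow> cinner u v = 0"
  then have "(norm u)\<^sup>2 = 0" by (simp add: power2_norm_eq_cinner)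
  then show "u = 0" by simp
qed (use assms sesquilinear_cinner in auto)

text \<open>
  Connects the denominator in \<^const>\<open>proj_ratio\<close> with the best approximation in \<^const>\<open>subspace_gap\<close>.
\<close>

lemma norm_diff_orth_proj_le:
  assumes S: "has_cdim S n" and y: "y \<in> S"
  shows "norm (x - orth_proj S x) \<le> norm (x - y)"
proof -
  interpret petrov_galerkin UNIV cinner S S n by (rule petrov_galerkin_orthogonal[OF S])
  define p where "p = orth_proj S x"
  have "p - y \<in> S"
    using proj[of x] y cvs.subspace_diff[OF has_cdim_subspace[OF S]] by (simp add: p_def)
  then have "cinner (p - y) (x - p) = 0"
    using proj(2)[of x "p - y"] by (simp add: p_def right_diff)
  then have "(norm ((p - y) + (x - p)))\<^sup>2 = (norm (p - y))\<^sup>2 + (norm (x - p))\<^sup>2"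
    by (simp only: norm_add_squared) simp
  then have "(norm (x - p))\<^sup>2 \<le> (norm (x - y))\<^sup>2" by simp
  then show ?thesis unfolding p_def by (rule power2_le_imp_le) simp
qed

section \<open>The Riesz representation on a dense subspace\<close>

text \<open>
  By polarization, continuity of the real part of the inner product is continuity of the norm.
\<close>

lemma cinner_Re_tendsto:
  assumes "X \<longlonglongrightarrow> (x :: 'a::complex_inner)"
  shows "(\<lambda>n. Re (cinner w (X n))) \<longlonglongrightarrow> Re (cinner w x)"
proof -
  have *: "Re (cinner w y) = ((norm (w + y))\<^sup>2 - (norm w)\<^sup>2 - (norm y)\<^sup>2) / 2" for y
    by (simp add: norm_add_squared)
  show ?thesis unfolding * by (intro tendsto_intros assms) simp
qed

lemma cinner_scaleR_right: "cinner w (s *\<^sub>R x) = s * cinner w (x :: 'a::complex_inner)"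
  by (simp add: scaleR_eq_scaleC cinner_scaleC_right)

lemma parallelogram_law:
  fixes x y :: "'a::complex_inner"
  shows "(norm (x - y))\<^sup>2 = 2 * (norm x)\<^sup>2 + 2 * (norm y)\<^sup>2 - 4 * (norm ((1/2) *\<^sub>R (x + y)))\<^sup>2"
proof -
  have "cinner x (- y) = - cinner x y"
    using cinner_scaleR_right[of x "-1" y] by simp
  moreover have "(norm ((1/2) *\<^sub>R (x + y)))\<^sup>2 = (norm (x + y))\<^sup>2 / 4"
    unfolding norm_scaleR by (simp add: power_mult_distrib power_divide)
  ultimately show ?thesis
    using norm_add_squared[of x "- y"] norm_add_squared[of x y] by simp
qed

text \<open>
  The representing vector is the limit of a minimizing sequence of the energy
  \<open>J w = \<parallel>w\<parallel>\<^sup>2 - 2 Re (F w)\<close>.  This limit may lie outside \<open>V\<close>: the parallelogram law makes the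
  sequence Cauchy in the whole space, and the variational inequality in directions of \<open>V\<close> is passed to
  the limit term by term, without evaluating \<open>J\<close> there.
\<close>

lemma riesz_representation_on_subspace:
  fixes V :: "'a::chilbert_space set"
  assumes V: "cvs.subspace V"
    and add: "\<And>u v. u \<in> V \<Longrightarrow> v \<in> V \<Longrightarrow> F (u + v) = F u + F v"
    and scale: "\<And>u c. u \<in> V \<Longrightarrow> F (c *\<^sub>C u) = cnj c * F u"
    and bound: "\<And>u. u \<in> V \<Longrightarrow> cmod (F u) \<le> m * norm u"
  shows "\<exists>f. \<forall>w\<in>V. F w = cinner w f"
proof -
  define J where "J w = (norm w)\<^sup>2 - 2 * Re (F w)" for w
  have scaleR: "s *\<^sub>R w \<in> V" "Re (F (s *\<^sub>R w)) = s * Re (F w)" if "w \<in> V" for s w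
    using that cvs.subspace_scale[OF V] scale by (simp_all add: scaleR_eq_scaleC)
  have J_lower: "- m\<^sup>2 \<le> J w" if "w \<in> V" for w
  proof -
    have "Re (F w) \<le> m * norm w" using bound[OF that] complex_Re_le_cmod[of "F w"] by linarith
    moreover have "0 \<le> (norm w - m)\<^sup>2" by simp
    ultimately show ?thesis by (simp add: J_def power2_diff) (simp add: mult.commute)
  qed
  have bdd: "bdd_below (J ` V)" using J_lower by (auto intro!: bdd_belowI)
  have ne: "V \<noteq> {}" using cvs.subspace_0[OF V] by blast
  define d where "d = (INF w\<in>V. J w)"
  have d: "d \<le> J w" if "w \<in> V" for w unfolding d_def using bdd that by (rule cINF_lower)
  have "\<exists>w\<in>V. J w < d + inverse (real (Suc n))" for n
    using cINF_less_iff[OF ne bdd, of "d + inverse (real (Suc n))"] by (simp add: d_def)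
  then obtain X where X: "\<And>n. X n \<in> V" "\<And>n. J (X n) < d + inverse (real (Suc n))" by metis
  have close: "(norm (X p - X q))\<^sup>2 < 2 * (inverse (real (Suc p)) + inverse (real (Suc q)))" for p q
  proof -
    have mid: "(1/2) *\<^sub>R (X p + X q) \<in> V"
      using X(1) cvs.subspace_add[OF V] scaleR(1) by blast
    have "Re (F ((1/2) *\<^sub>R (X p + X q))) = (Re (F (X p)) + Re (F (X q))) / 2"
      using X(1) cvs.subspace_add[OF V] by (simp add: scaleR(2) add)
    then have "(norm (X p - X q))\<^sup>2 = 2 * (J (X p) + J (X q) - 2 * J ((1/2) *\<^sub>R (X p + X q)))"
      unfolding J_def parallelogram_law[of "X p"] by (simp only:) (simp add: algebra_simps)
    moreover have "2 * (x + y - 2 * l) < 2 * (i + j)"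
      if "d \<le> l" "x < d + i" "y < d + j" for x y l i j :: real
      using that by argo
    ultimately show ?thesis using d[OF mid] X(2)[of p] X(2)[of q] by simp
  qed
  have "Cauchy X"
  proof (rule metric_CauchyI)
    fix e :: real assume e: "0 < e"
    obtain N where N: "inverse (real (Suc N)) < e\<^sup>2 / 4"
      using reals_Archimedean[of "e\<^sup>2 / 4"] e by auto
    have "dist (X p) (X q) < e" if "N \<le> p" "N \<le> q" for p q
    proof -
      have "inverse (real (Suc p)) \<le> inverse (real (Suc N))"
           "inverse (real (Suc q)) \<le> inverse (real (Suc N))"
        using that by (auto intro!: le_imp_inverse_le)
      with close[of p q] N have "(norm (X p - X q))\<^sup>2 < e\<^sup>2" by argo
      then show ?thesis using e by (simp add: dist_norm power2_less_imp_less)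
    qed
    then show "\<exists>N. \<forall>p\<ge>N. \<forall>q\<ge>N. dist (X p) (X q) < e" by blast
  qed
  then obtain f where f: "X \<longlonglongrightarrow> f" using Cauchy_convergent convergent_def by blast
  have variation: "0 \<le> 2 * t * (Re (cinner w f) - Re (F w)) + t\<^sup>2 * (norm w)\<^sup>2" if w: "w \<in> V" for w t
  proof (rule LIMSEQ_le_const)
    show "(\<lambda>n. inverse (real (Suc n)) + 2 * t * (Re (cinner w (X n)) - Re (F w)) + t\<^sup>2 * (norm w)\<^sup>2)
      \<longlonglongrightarrow> 2 * t * (Re (cinner w f) - Re (F w)) + t\<^sup>2 * (norm w)\<^sup>2"
      by (rule tendsto_eq_intros LIMSEQ_inverse_real_of_nat cinner_Re_tendsto f refl | simp)+
    have "0 \<le> inverse (real (Suc n)) + 2 * t * (Re (cinner w (X n)) - Re (F w)) + t\<^sup>2 * (norm w)\<^sup>2" for n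
    proof -
      have "J (X n + t *\<^sub>R w) = J (X n) + 2 * t * (Re (cinner w (X n)) - Re (F w)) + t\<^sup>2 * (norm w)\<^sup>2"
        using w X(1) scaleR[OF w, of t] Re_cinner_commute[of "X n" w]
        by (simp add: J_def norm_add_squared add cinner_scaleR_right power_mult_distrib algebra_simps)
      moreover have "d \<le> J (X n + t *\<^sub>R w)"
        using w X(1) scaleR(1) cvs.subspace_add[OF V] by (intro d) blast
      ultimately show ?thesis using X(2)[of n] by linarith
    qed
    then show "\<exists>N. \<forall>n\<ge>N. 0 \<le> inverse (real (Suc n)) + 2 * t * (Re (cinner w (X n)) - Re (F w)) + t\<^sup>2 * (norm w)\<^sup>2"
      by blast
  qed
  have Re_eq: "Re (F w) = Re (cinner w f)" if w: "w \<in> V" for w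
  proof -
    define g where "g = Re (cinner w f) - Re (F w)"
    define s where "s = (norm w)\<^sup>2 + 1"
    have s: "0 < s" by (simp add: s_def add_nonneg_pos)
    \<comment> \<open>The minimizer of the quadratic with \<open>s\<close> in place of the possibly zero coefficient \<open>\<parallel>w\<parallel>\<^sup>2\<close>.\<close>
    have "0 \<le> 2 * (- g / s) * g + (- g / s)\<^sup>2 * (norm w)\<^sup>2"
      using variation[OF w, of "- g / s"] by (simp add: g_def)
    also have "\<dots> = (g\<^sup>2 / s) * ((norm w)\<^sup>2 / s - 2)"
      using s by (simp add: power2_eq_square field_simps)
    finally have "0 \<le> (g\<^sup>2 / s) * ((norm w)\<^sup>2 / s - 2)" .
    moreover have "(norm w)\<^sup>2 / s - 2 < 0" using s by (simp add: s_def field_simps)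
    ultimately have "g\<^sup>2 / s \<le> 0" by (meson mult_pos_neg not_le)
    then have "g = 0" using s by (simp add: field_simps)
    then show ?thesis by (simp add: g_def)
  qed
  have "F w = cinner w f" if w: "w \<in> V" for w
  proof (rule complex_eqI)
    \<comment> \<open>Imaginary parts are real parts in the direction \<open>\<i> w\<close>.\<close>
    show "Im (F w) = Im (cinner w f)"
      using Re_eq[of "\<i> *\<^sub>C w"] cvs.subspace_scale[OF V w] by (simp add: scale[OF w] cinner_scaleC_left)
  qed (rule Re_eq[OF w])
  then show ?thesis by blast
qed

section \<open>The operator associated with a form\<close>

lemma eq_if_cinner_eq_on_dense:
  fixes V :: "'a::complex_inner set"
  assumes dense: "closure V = UNIV" and eq: "\<And>w. w \<in> V \<Longrightarrow> cinner w f = cinner w g"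
  shows "f = g"
proof -
  have "f - g \<in> closure V" using dense by simp
  then obtain X where X: "\<And>n. X n \<in> V" "X \<longlonglongrightarrow> f - g" by (auto simp: closure_sequential)
  have "cinner (X n) (f - g) = 0" for n
    using eq[OF X(1)] cinner_add_right[of "X n" "f - g" g] by simp
  then have "Re (cinner (f - g) (X n)) = 0" for n
    using Re_cinner_commute[of "f - g" "X n"] by simp
  then have "Re (cinner (f - g) (f - g)) = 0"
    using cinner_Re_tendsto[OF X(2), of "f - g"] LIMSEQ_unique[OF tendsto_const] by force
  then show ?thesis by (simp flip: power2_norm_eq_cinner)
qed

locale densely_defined_form =
  fixes V :: "'a::chilbert_space set" and a :: "'a \<Rightarrow> 'a \<Rightarrow> complex"
  assumes V: "cvs.subspace V" and dense: "closure V = UNIV" and a: "sesquilinear_on V a"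
begin

lemma form_dom_subset: "form_dom V a \<subseteq> V"
  by (auto simp: form_dom_def)

lemma form_op_eqI:
  assumes "\<And>w. w \<in> V \<Longrightarrow> a w v = cinner w f" shows "form_op V a v = f"
  unfolding form_op_def
  using assms eq_if_cinner_eq_on_dense[OF dense] by (intro the_equality) metis+

text \<open>
  The defining identity of the operator.  The description operator in \<^const>\<open>form_op\<close> conveys
  nothing until a representing vector is known to exist, which is where the Riesz theorem enters.
\<close>

lemma form_op:
  assumes v: "v \<in> form_dom V a" and w: "w \<in> V"
  shows "a w v = cinner w (form_op V a v)"
proof -
  from v obtain m where m: "\<And>w. w \<in> V \<Longrightarrow> cmod (a w v) \<le> m * norm w"
    by (auto simp: form_dom_def)
  have "\<exists>f. \<forall>w\<in>V. a w v = cinner w f"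
    using a v form_dom_subset m
    by (intro riesz_representation_on_subspace[OF V, of "\<lambda>w. a w v" m]) (auto simp: sesquilinear_on_def)
  then show ?thesis using form_op_eqI w by metis
qed

lemma clinear_on_form_op: 
  assumes "S \<subseteq> form_dom V a" shows "clinear_on S (form_op V a)"
proof (rule clinear_onI)
  fix x y assume "x \<in> S" "y \<in> S"
  then show "form_op V a (x + y) = form_op V a x + form_op V a y"
    using assms form_dom_subset a
    by (intro form_op_eqI) (simp add: cinner_add_right subset_iff sesquilinear_on_def flip: form_op)
next
  fix x c assume "x \<in> S"
  then show "form_op V a (c *\<^sub>C x) = c *\<^sub>C form_op V a x"
    using assms form_dom_subset a
    by (intro form_op_eqI) (simp add: cinner_scaleC_right subset_iff sesquilinear_on_def flip: form_op)
qed

end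

section \<open>The resolvent on a generalized eigenspace\<close>

lemma gen_eigenspace_subset_dom: "gen_eigenspace D L z \<subseteq> D"
proof
  fix v assume "v \<in> gen_eigenspace D L z"
  then obtain k where "1 \<le> k" "v \<in> pow_ker D (\<lambda>v. L v - z *\<^sub>C v) k"
    by (auto simp: gen_eigenspace_def)
  then show "v \<in> D" by (cases k) (auto simp: pow_ker_def)
qed

lemma gen_eigenspace_invariant:
  assumes v: "v \<in> gen_eigenspace D L z" and 0: "0 \<in> gen_eigenspace D L z"
  shows "L v - z *\<^sub>C v \<in> gen_eigenspace D L z"
proof -
  let ?N = "\<lambda>v. L v - z *\<^sub>C v"
  obtain k where k: "1 \<le> k" "v \<in> pow_ker D ?N k"
    using v by (auto simp: gen_eigenspace_def)
  then obtain j where j: "k = Suc j" by (cases k) auto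
  have Nv: "?N v \<in> pow_ker D ?N j"
    using k(2) unfolding j pow_ker_def by (simp add: funpow_Suc_right del: funpow.simps)
  show ?thesis
  proof (cases "j = 0")
    case True
    then have "?N v = 0" using Nv by (simp add: pow_ker_def)
    with 0 show ?thesis by simp
  next
    case False
    then show ?thesis using Nv unfolding gen_eigenspace_def by auto
  qed
qed

lemma gen_eigenspace_nilpotent:
  assumes "v \<in> gen_eigenspace D L z"
  obtains k where "0 < k" "((\<lambda>v. L v - z *\<^sub>C v) ^^ k) v = 0"
proof -
  obtain k where "1 \<le> k" "((\<lambda>v. L v - z *\<^sub>C v) ^^ k) v = 0"
    using assms by (auto simp: gen_eigenspace_def pow_ker_def)
  then show ?thesis by (intro that[of k]) auto
qed

text \<open>
  With \<open>N = L - c\<close>, the partial sums of the Neumann series \<open>(z - L)\<inverse> = (\<Sum>j. N\<^sup>j / (z - c)\<^bsup>j+1\<^esup>)\<close>.  On a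
  vector that some power of \<open>N\<close> annihilates, the series terminates, so the resolvent is a Laurent
  polynomial in \<open>z - c\<close> with coefficients in the generalized eigenspace.
\<close>

definition resolvent_sum :: "('a \<Rightarrow> 'a) \<Rightarrow> complex \<Rightarrow> nat \<Rightarrow> 'a::complex_inner \<Rightarrow> complex \<Rightarrow> 'a"
  where "resolvent_sum L c k u z =
    (\<Sum>j<k. inverse ((z - c) ^ Suc j) *\<^sub>C ((\<lambda>v. L v - c *\<^sub>C v) ^^ j) u)"

lemma funpow_in:
  "(\<And>x. x \<in> W \<Longrightarrow> f x \<in> W) \<Longrightarrow> u \<in> W \<Longrightarrow> (f ^^ j) u \<in> W"
  by (induction j) auto

lemma resolvent_sum_in:
  assumes "cvs.subspace W" "\<And>v. v \<in> W \<Longrightarrow> L v - c *\<^sub>C v \<in> W" "u \<in> W"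
  shows "resolvent_sum L c k u z \<in> W"
  unfolding resolvent_sum_def
  by (intro cvs.subspace_sum cvs.subspace_scale assms(1) funpow_in[OF assms(2,3)])

lemma resolvent_sum_telescopes:
  assumes W: "cvs.subspace W" and L: "clinear_on W L"
    and inv: "\<And>v. v \<in> W \<Longrightarrow> L v - c *\<^sub>C v \<in> W" and u: "u \<in> W" and z: "z \<noteq> c"
  shows "z *\<^sub>C resolvent_sum L c k u z - L (resolvent_sum L c k u z) =
    u - inverse ((z - c) ^ k) *\<^sub>C ((\<lambda>v. L v - c *\<^sub>C v) ^^ k) u"
proof (induction k)
  case 0
  then show ?case using clinear_on_zero[OF L W] by (simp add: resolvent_sum_def)
next
  case (Suc k)
  define s where "s = resolvent_sum L c k u z"
  define y where "y = ((\<lambda>v. L v - c *\<^sub>C v) ^^ k) u"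
  define q where "q = inverse ((z - c) ^ Suc k)"
  have s: "s \<in> W" unfolding s_def by (rule resolvent_sum_in[OF W inv u])
  have y: "y \<in> W" unfolding y_def using inv u by (rule funpow_in)
  have "q * (z - c) = inverse ((z - c) ^ k)"
    unfolding q_def power_Suc inverse_mult_distrib using z by (metis left_inverse mult.assoc mult.commute mult_1 right_minus_eq)
  then have "q *\<^sub>C ((z - c) *\<^sub>C y) = inverse ((z - c) ^ k) *\<^sub>C y" by (simp add: scaleC_scaleC)
  moreover have "z *\<^sub>C y - L y = (z - c) *\<^sub>C y - (L y - c *\<^sub>C y)"
    unfolding cvs.scale_left_diff_distrib by simp
  ultimately have q: "q *\<^sub>C (z *\<^sub>C y - L y) = inverse ((z - c) ^ k) *\<^sub>C y - q *\<^sub>C (L y - c *\<^sub>C y)"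
    by (simp only: cvs.scale_right_diff_distrib)
  have "z *\<^sub>C (s + q *\<^sub>C y) - L (s + q *\<^sub>C y) = (z *\<^sub>C s - L s) + q *\<^sub>C (z *\<^sub>C y - L y)"
    using s y cvs.subspace_scale[OF W y, of q]
    by (simp add: clinear_on_add[OF L] clinear_on_scaleC[OF L] scaleC_add_right
        cvs.scale_right_diff_distrib scaleC_scaleC mult.commute)
  also have "\<dots> = u - q *\<^sub>C (L y - c *\<^sub>C y)"
    unfolding q using Suc.IH by (simp add: s_def y_def)
  finally show ?case by (simp add: resolvent_sum_def s_def y_def q_def)
qed

section \<open>Integrals over circles\<close>

lemma has_contour_integral_circlepath_inverse_power:
  assumes "0 < r"
  shows "((\<lambda>z. inverse ((z - c) ^ Suc j)) has_contour_integral (if j = 0 then 2 * pi * \<i> else 0))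
    (circlepath c r)"
proof -
  have "((\<lambda>z. 1 / (z - c) ^ Suc j) has_contour_integral
      (2 * pi * \<i> / fact j * (deriv ^^ j) (\<lambda>_. 1) c)) (circlepath c r)"
    using assms by (intro Cauchy_has_contour_integral_higher_derivative_circlepath) auto
  then show ?thesis by (simp add: higher_deriv_const divide_inverse split: if_splits)
qed

text \<open>
  Only the simple pole contributes to the integral of such a Laurent polynomial.
\<close>

lemma has_integral_circlepath_resolvent_sum:
  fixes x :: "nat \<Rightarrow> 'a::chilbert_space"
  assumes "0 < r" "0 < k"
  shows "((\<lambda>t. vector_derivative (circlepath c r) (at t within {0..1}) *\<^sub>C
      (\<Sum>j<k. inverse ((circlepath c r t - c) ^ Suc j) *\<^sub>C x j)) has_integral
    (2 * complex_of_real pi * \<i>) *\<^sub>C x 0) {0..1}"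
proof -
  let ?d = "\<lambda>t. vector_derivative (circlepath c r) (at t within {0..1})"
  have "((\<lambda>t. \<Sum>j<k. (inverse ((circlepath c r t - c) ^ Suc j) * ?d t) *\<^sub>C x j) has_integral
    (\<Sum>j<k. (if j = 0 then 2 * complex_of_real pi * \<i> else 0) *\<^sub>C x j)) {0..1}"
  proof (intro has_integral_sum)
    fix j
    note * = has_contour_integral_circlepath_inverse_power[OF assms(1), of c j,
      unfolded has_contour_integral_def]
    show "((\<lambda>t. (inverse ((circlepath c r t - c) ^ Suc j) * ?d t) *\<^sub>C x j) has_integral
      (if j = 0 then 2 * complex_of_real pi * \<i> else 0) *\<^sub>C x j) {0..1}"
      using has_integral_linear[OF * bounded_bilinear.bounded_linear_left[OF bounded_bilinear_scaleC]]
      by (simp only: o_def of_real_mult of_real_numeral if_distrib)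
  qed simp
  also have "(\<Sum>j<k. (if j = 0 then 2 * complex_of_real pi * \<i> else 0) *\<^sub>C x j) =
      (\<Sum>j<k. if j = 0 then (2 * complex_of_real pi * \<i>) *\<^sub>C x j else 0)"
    by (intro sum.cong) auto
  also have "\<dots> = (2 * complex_of_real pi * \<i>) *\<^sub>C x 0"
    using assms(2) by (subst sum.delta) auto
  finally show ?thesis by (simp add: cvs.scale_sum_right scaleC_scaleC mult.commute)
qed

text \<open>
  A Riesz projection is compared with any vector \<open>p\<close> that has an integral representation over the
  same circle: the circle has length \<open>2 \<pi> r\<close>, and the factor \<open>2 \<pi>\<close> cancels.
\<close>

lemma norm_riesz_projection_diff_le:
  assumes r: "0 < r"
    and cont: "continuous_on (sphere c r) (\<lambda>z. resolvent D L z x)"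
    and f: "((\<lambda>t. vector_derivative (circlepath c r) (at t within {0..1}) *\<^sub>C f (circlepath c r t))
      has_integral (2 * complex_of_real pi * \<i>) *\<^sub>C p) {0..1}"
    and B: "\<And>z. z \<in> sphere c r \<Longrightarrow> norm (resolvent D L z x - f z) \<le> B"
  shows "norm (riesz_projection D L c r x - p) \<le> r * B"
proof -
  let ?g = "circlepath c r"
  let ?d = "\<lambda>t. vector_derivative ?g (at t within {0..1})"
  let ?R = "\<lambda>t. ?d t *\<^sub>C resolvent D L (?g t) x"
  have sphere: "?g t \<in> sphere c r" if "t \<in> {0..1}" for t
    using that path_image_circlepath_nonneg[of r c] r by (auto simp: path_image_def)
  have d: "?d t = 2 * pi * \<i> * r * exp (2 * of_real pi * \<i> * t)" if "t \<in> {0..1}" for t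
    using that by (intro vector_derivative_circlepath01) auto
  have "norm (resolvent D L (?g 0) x - f (?g 0)) \<le> B" by (rule B[OF sphere]) simp
  then have "B \<ge> 0" by (rule order_trans[OF norm_ge_zero])
  have "continuous_on {0..1} ?d"
    by (subst continuous_on_cong[OF refl d]) (auto intro!: continuous_intros)
  moreover have "continuous_on {0..1} (\<lambda>t. resolvent D L (?g t) x)"
    using continuous_on_compose2[OF cont, of "{0..1}" ?g] sphere path_circlepath[of c r]
    unfolding path_def by blast
  ultimately have "continuous_on {0..1} ?R"
    by (rule bounded_bilinear.continuous_on[OF bounded_bilinear_scaleC])
  then have "(?R has_integral integral {0..1} ?R) {0..1}"
    using integrable_continuous_real has_integral_integral by blast
  from has_integral_diff[OF this f]
  have diff: "((\<lambda>t. ?d t *\<^sub>C (resolvent D L (?g t) x - f (?g t))) has_integral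
      integral {0..1} ?R - (2 * complex_of_real pi * \<i>) *\<^sub>C p) {0..1}"
    by (simp add: cvs.scale_right_diff_distrib)
  have "norm (integral {0..1} ?R - (2 * complex_of_real pi * \<i>) *\<^sub>C p) \<le>
      (2 * pi * r * B) * measure lborel {0..1::real}"
  proof (rule has_integral_bound[OF _ diff[folded box_real(2)], unfolded box_real(2)])
    fix t :: real assume t: "t \<in> {0..1}"
    have "cmod (?d t) = 2 * pi * r" unfolding d[OF t] using r by (simp add: norm_mult)
    then show "norm (?d t *\<^sub>C (resolvent D L (?g t) x - f (?g t))) \<le> 2 * pi * r * B"
      using B[OF sphere[OF t]] r by (simp add: norm_scaleC mult_left_mono)
  qed (use r \<open>B \<ge> 0\<close> in simp)
  then have bound: "norm (integral {0..1} ?R - (2 * complex_of_real pi * \<i>) *\<^sub>C p) \<le> 2 * pi * r * B"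
    by simp
  have "riesz_projection D L c r x - p = (1 / (2 * complex_of_real pi * \<i>)) *\<^sub>C
      (integral {0..1} ?R - (2 * complex_of_real pi * \<i>) *\<^sub>C p)"
    by (simp add: riesz_projection_def cvs.scale_right_diff_distrib scaleC_scaleC)
  then have "norm (riesz_projection D L c r x - p) =
      norm (integral {0..1} ?R - (2 * complex_of_real pi * \<i>) *\<^sub>C p) / (2 * pi)"
    by (simp add: norm_scaleC norm_divide norm_mult)
  also have "\<dots> \<le> (2 * pi * r * B) / (2 * pi)"
    using bound by (intro divide_right_mono) auto
  finally show ?thesis by simp
qed

section \<open>Uniform resolvent bounds\<close>

text \<open>
  A resolvent bound \<open>k\<close> at \<open>z\<close> persists, doubled, on the disc of radius \<open>1 / (2 k)\<close> about \<open>z\<close>; finitely many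
  such discs cover a compact set.
\<close>

lemma resolvent_bound_compact:
  assumes C: "compact C" "C \<subseteq> resolvent_set D L"
  obtains K where "0 < K" "\<And>z x. z \<in> C \<Longrightarrow> x \<in> D \<Longrightarrow> norm x \<le> K * norm (z *\<^sub>C x - L x)"
proof -
  have "\<exists>K>0. \<forall>x\<in>D. norm x \<le> K * norm (z *\<^sub>C x - L x)" if "z \<in> C" for z
  proof -
    have "z \<in> resolvent_set D L" using that C(2) by blast
    then obtain K where K: "\<forall>x\<in>D. norm x \<le> K * norm (z *\<^sub>C x - L x)"
      unfolding resolvent_set_def by blast
    have "norm x \<le> max 1 K * norm (z *\<^sub>C x - L x)" if "x \<in> D" for x
      using K that by (meson max.cobounded2 mult_right_mono norm_ge_zero order_trans)
    then show ?thesis by (intro exI[of _ "max 1 K"]) auto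
  qed
  then obtain k where k: "\<And>z. z \<in> C \<Longrightarrow> 0 < k z"
    "\<And>z x. z \<in> C \<Longrightarrow> x \<in> D \<Longrightarrow> norm x \<le> k z * norm (z *\<^sub>C x - L x)" by metis
  have near: "norm x \<le> 2 * k z * norm (w *\<^sub>C x - L x)"
    if "z \<in> C" "x \<in> D" and w: "w \<in> ball z (1 / (2 * k z))" for z w x
  proof -
    have "z *\<^sub>C x - L x = (w *\<^sub>C x - L x) + (z - w) *\<^sub>C x" by (simp add: algebra_simps)
    then have "norm (z *\<^sub>C x - L x) \<le> norm (w *\<^sub>C x - L x) + cmod (z - w) * norm x"
      by (metis norm_scaleC norm_triangle_ineq)
    also have "cmod (z - w) * norm x \<le> 1 / (2 * k z) * norm x"
      using w by (intro mult_right_mono) (auto simp: dist_norm)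
    finally have "k z * norm (z *\<^sub>C x - L x) \<le> k z * (norm (w *\<^sub>C x - L x) + 1 / (2 * k z) * norm x)"
      using k(1)[OF that(1)] by (intro mult_left_mono) auto
    also have "\<dots> = k z * norm (w *\<^sub>C x - L x) + norm x / 2"
      using k(1)[OF that(1)] by (simp add: field_simps)
    finally show ?thesis using k(2)[OF that(1,2)] by simp
  qed
  obtain F where F: "F \<subseteq> C" "finite F" "C \<subseteq> (\<Union>z\<in>F. ball z (1 / (2 * k z)))"
  proof (rule compactE_image[OF C(1), of C "\<lambda>z. ball z (1 / (2 * k z))"])
    show "C \<subseteq> (\<Union>z\<in>C. ball z (1 / (2 * k z)))" using k(1) by force
  qed auto
  define K where "K = 1 + (\<Sum>z\<in>F. 2 * k z)"
  have pos: "0 \<le> k z" if "z \<in> F" for z using k(1) that F(1) by (meson less_imp_le subsetD)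
  have le_K: "2 * k z \<le> K" if "z \<in> F" for z
    using member_le_sum[of z F "\<lambda>z. 2 * k z"] that F(2) pos by (simp add: K_def)
  have "norm x \<le> K * norm (w *\<^sub>C x - L x)" if w: "w \<in> C" and x: "x \<in> D" for w x
  proof -
    obtain z where z: "z \<in> F" "w \<in> ball z (1 / (2 * k z))" using F(3) w by blast
    then have "norm x \<le> 2 * k z * norm (w *\<^sub>C x - L x)" using near F(1) x by blast
    also have "\<dots> \<le> K * norm (w *\<^sub>C x - L x)" using le_K[OF z(1)] by (intro mult_right_mono) auto
    finally show ?thesis .
  qed
  moreover have "0 < K" unfolding K_def using pos by (intro add_pos_nonneg sum_nonneg) auto
  ultimately show ?thesis by (rule that[rotated])
qed

text \<open>
  A lower bound on \<open>z - B\<close> passes to every operator whose graph is close to that of \<open>B\<close>: each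
  \<open>x \<in> D\<close> is near some \<open>y \<in> D'\<close> with \<open>B y\<close> near \<open>L x\<close>, so \<open>(z - L) x\<close> is near \<open>(z - B) y\<close>.  The errors are
  relative to \<open>\<parallel>x\<parallel> + \<parallel>L x\<parallel>\<close>, which is at most \<open>(1 + R) \<parallel>x\<parallel> + \<parallel>(z - L) x\<parallel>\<close>; the threshold for the gap is
  chosen so that they consume half of \<open>\<parallel>x\<parallel>\<close>.
\<close>

lemma resolvent_bound_operator_gap:
  assumes K: "0 < K" "\<And>y. y \<in> D' \<Longrightarrow> norm y \<le> K * norm (z *\<^sub>C y - B y)"
    and R: "cmod z \<le> R" "0 < R"
    and gap: "operator_gap D L D' B < ennreal (1 / (2 * (1 + R) * (1 + K * (1 + R))))"
    and x: "x \<in> D"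
  shows "norm x \<le> (2 * K + 1) * norm (z *\<^sub>C x - L x)"
proof (cases "x = 0")
  case False
  define \<kappa> where "\<kappa> = 1 + K * (1 + R)"
  define \<delta> where "\<delta> = 1 / (2 * (1 + R) * \<kappa>)"
  define g where "g = norm (z *\<^sub>C x - L x)"
  define s where "s = norm x + norm (L x)"
  have \<kappa>: "1 \<le> \<kappa>" using K R by (simp add: \<kappa>_def)
  then have \<delta>: "0 < \<delta>" using R by (simp add: \<delta>_def)
  have s: "0 < s" using False by (simp add: s_def add_pos_nonneg)
  have "(INF y\<in>D'. ennreal ((norm (x - y) + norm (L x - B y)) / s)) < ennreal \<delta>"
    unfolding s_def \<delta>_def \<kappa>_def
    by (rule order.strict_trans1[OF _ gap], unfold operator_gap_def, rule SUP_upper) (use x False in simp)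
  then obtain y where y: "y \<in> D'" "ennreal ((norm (x - y) + norm (L x - B y)) / s) < ennreal \<delta>"
    by (auto simp: INF_less_iff)
  then have "(norm (x - y) + norm (L x - B y)) / s < \<delta>"
    using s by (simp add: ennreal_less_iff)
  then have dist: "norm (x - y) + norm (L x - B y) \<le> \<delta> * s"
    using s by (simp add: field_simps)
  have "z *\<^sub>C y - B y = (z *\<^sub>C x - L x) - z *\<^sub>C (x - y) + (L x - B y)" by (simp add: algebra_simps)
  then have "norm (z *\<^sub>C y - B y) \<le> norm ((z *\<^sub>C x - L x) - z *\<^sub>C (x - y)) + norm (L x - B y)"
    by (metis norm_triangle_ineq)
  also have "\<dots> \<le> g + norm (z *\<^sub>C (x - y)) + norm (L x - B y)"
    unfolding g_def by (intro add_right_mono norm_triangle_ineq4)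
  also have "norm (z *\<^sub>C (x - y)) \<le> R * norm (x - y)"
    unfolding norm_scaleC using R by (intro mult_right_mono) auto
  also have "g + R * norm (x - y) + norm (L x - B y) \<le> g + (1 + R) * (norm (x - y) + norm (L x - B y))"
    using R by (simp add: algebra_simps)
  also have "\<dots> \<le> g + (1 + R) * (\<delta> * s)"
    using dist R by (intro add_left_mono mult_left_mono) auto
  finally have "K * norm (z *\<^sub>C y - B y) \<le> K * (g + (1 + R) * (\<delta> * s))"
    using K(1) by (intro mult_left_mono) auto
  with K(2)[OF y(1)] have "norm y \<le> K * (g + (1 + R) * (\<delta> * s))" by linarith
  moreover have "norm x \<le> norm y + \<delta> * s"
    using norm_triangle_sub[of x y] dist norm_ge_zero[of "L x - B y"] by linarith
  ultimately have 1: "norm x \<le> K * g + \<delta> * \<kappa> * s" by (simp add: \<kappa>_def algebra_simps)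
  have "norm (L x) \<le> norm (z *\<^sub>C x) + g"
    using norm_triangle_sub[of "L x" "z *\<^sub>C x"] by (simp add: g_def norm_minus_commute)
  also have "norm (z *\<^sub>C x) \<le> R * norm x"
    unfolding norm_scaleC using R by (intro mult_right_mono) auto
  finally have "s \<le> (1 + R) * norm x + g" by (simp add: s_def algebra_simps)
  then have "\<delta> * \<kappa> * s \<le> \<delta> * \<kappa> * ((1 + R) * norm x + g)"
    using \<delta> \<kappa> by (intro mult_left_mono) auto
  also have "\<dots> = norm x / 2 + g / (2 * (1 + R))"
  proof -
    have split: "(t * y + g) / (2 * t) = y / 2 + g / (2 * t)" if "0 < t" for t y :: real
      using that by (simp add: add_divide_distrib)
    have "\<delta> * \<kappa> = 1 / (2 * (1 + R))" using \<kappa> by (simp add: \<delta>_def)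
    then show ?thesis using split[of "1 + R" "norm x"] R by simp
  qed
  also have "g / (2 * (1 + R)) \<le> g / 2"
    using R by (intro divide_left_mono) (auto simp: g_def)
  finally show ?thesis using 1 by (simp add: g_def algebra_simps)
qed (use K(1) in simp)

section \<open>The Galerkin approximation of a form operator\<close>

locale galerkin_approximation =
  form: densely_defined_form V a +
  aproj: petrov_galerkin V a S1 S2 n +
  hproj: petrov_galerkin UNIV cinner S1 S2 n
  for V :: "'a::chilbert_space set" and a :: "'a \<Rightarrow> 'a \<Rightarrow> complex" and S1 S2 :: "'a set" and n :: nat
begin

abbreviation "P \<equiv> galerkin_proj a S1 S2"
abbreviation "Q \<equiv> galerkin_proj cinner S1 S2"
abbreviation "Ah \<equiv> galerkin_op a S1 S2"
abbreviation "A \<equiv> form_op V a"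
abbreviation "R \<equiv> resolvent UNIV Ah"

lemma S1_subspace: "cvs.subspace S1"
  by (rule has_cdim_subspace[OF aproj.S1])

lemma ex1_Ah: "\<exists>!y. y \<in> S1 \<and> (\<forall>u\<in>S2. cinner u y = a u (Q x))"
  using hproj.proj(1)[of x] aproj.S1V aproj.S2V
  by (intro hproj.ex1_representing) (auto simp: subset_iff aproj.left_add aproj.left_scaleC)

lemma Ah_in: "Ah x \<in> S1" and Ah_test: "u \<in> S2 \<Longrightarrow> cinner u (Ah x) = a u (Q x)"
  using theI'[OF ex1_Ah[of x]] by (auto simp: galerkin_op_def)

lemma Ah_unique: "y \<in> S1 \<Longrightarrow> (\<And>u. u \<in> S2 \<Longrightarrow> cinner u y = a u (Q x)) \<Longrightarrow> Ah x = y"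
  using ex1_Ah[of x] Ah_in Ah_test by blast

lemma clinear_on_Ah: "clinear_on UNIV Ah"
proof (rule clinear_onI)
  have QV: "Q x \<in> V" for x using hproj.proj(1) aproj.S1V by blast
  have S2V: "u \<in> V" if "u \<in> S2" for u using that aproj.S2V by blast
  show "Ah (x + y) = Ah x + Ah y" for x y
    using QV S2V cvs.subspace_add[OF S1_subspace] Ah_in clinear_on_add[OF hproj.clinear_on_proj]
    by (intro Ah_unique) (auto simp: cinner_add_right Ah_test aproj.right_add)
  show "Ah (c *\<^sub>C x) = c *\<^sub>C Ah x" for x c
    using QV S2V cvs.subspace_scale[OF S1_subspace] Ah_in clinear_on_scaleC[OF hproj.clinear_on_proj]
    by (intro Ah_unique) (auto simp: cinner_scaleC_right Ah_test aproj.right_scaleC)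
qed

lemma Ah_diff: "Ah (x - y) = Ah x - Ah y"
  by (rule clinear_on_diff[OF clinear_on_Ah]) auto

lemma Ah_add: "Ah (x + y) = Ah x + Ah y"
  by (rule clinear_on_add[OF clinear_on_Ah]) auto

text \<open>
  The reason for comparing the two projections: on the domain of \<open>A\<close>, the projection \<open>P\<close> intertwines
  \<open>A\<close> with the discrete operator up to \<open>Q\<close>, because both sides have the same products \<open>a u w\<close> with test
  vectors \<open>u\<close>.  Hence \<open>Q w\<close> satisfies the discrete resolvent equation up to a defect \<open>Ah (P w - Q w)\<close>.
\<close>

lemma Ah_P_eq_Q_A:
  assumes w: "w \<in> form_dom V a" shows "Ah (P w) = Q (A w)"
proof (rule Ah_unique)
  show "Q (A w) \<in> S1" by (simp add: hproj.proj)
  have wV: "w \<in> V" using w form.form_dom_subset by blast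
  fix u assume u: "u \<in> S2"
  then have "cinner u (Q (A w)) = cinner u (A w)" by (simp add: hproj.proj)
  also have "\<dots> = a u w" using u aproj.S2V form.form_op[OF w] by auto
  also have "\<dots> = a u (P w)" using aproj.proj(2)[OF wV u] by simp
  also have "P w = Q (P w)" using hproj.proj_id[OF aproj.proj(1)[OF wV]] by simp
  finally show "cinner u (Q (A w)) = a u (Q (P w))" .
qed

lemma Ah_defect:
  assumes w: "w \<in> form_dom V a"
  shows "z *\<^sub>C Q w - Ah (Q w) = Q (z *\<^sub>C w - A w) + Ah (P w - Q w)"
proof -
  have "Q (z *\<^sub>C w - A w) = z *\<^sub>C Q w - Ah (P w)"
    using clinear_on_diff[OF hproj.clinear_on_proj, of "z *\<^sub>C w" "A w"]
      clinear_on_scaleC[OF hproj.clinear_on_proj, of w z] by (simp add: Ah_P_eq_Q_A[OF w])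
  then show ?thesis by (simp add: Ah_diff)
qed

text \<open>
  The discrete operator acts on the whole space, but a solution of the resolvent equation with
  right-hand side in \<open>S1\<close> lies in \<open>S1\<close> itself, since \<open>z \<noteq> 0\<close> and the discrete operator has range in \<open>S1\<close>.
\<close>

lemma resolvent_Ah:
  assumes C: "\<And>x. x \<in> S1 \<Longrightarrow> norm x \<le> C * norm (z *\<^sub>C x - Ah x)" and z: "z \<noteq> 0" and q: "q \<in> S1"
  shows "z *\<^sub>C R z q - Ah (R z q) = q" "R z q \<in> S1"
proof -
  let ?T = "\<lambda>x. z *\<^sub>C x - Ah x"
  have "?T ` S1 = S1"
  proof (rule injective_surjective_of_equal_cdim[OF aproj.S1 aproj.S1])
    show "clinear_on S1 ?T"
      using clinear_on_shift[OF clinear_on_Ah] clinear_on_subset by blast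
    show "?T ` S1 \<subseteq> S1"
      by (auto intro!: cvs.subspace_diff cvs.subspace_scale S1_subspace Ah_in)
    show "x = 0" if "x \<in> S1" "?T x = 0" for x using C[OF that(1)] that(2) by simp
  qed
  then have "q \<in> range ?T" using q by blast
  then show eq: "?T (R z q) = q" unfolding resolvent_def by (rule f_inv_into_f)
  have "inverse z *\<^sub>C (q + Ah (R z q)) = inverse z *\<^sub>C (z *\<^sub>C R z q)"
    using eq by (simp add: diff_eq_eq)
  also have "\<dots> = R z q" using z by (simp add: scaleC_scaleC)
  finally show "R z q \<in> S1"
    using cvs.subspace_scale[OF S1_subspace] cvs.subspace_add[OF S1_subspace q Ah_in] by metis
qed

text \<open>
  The defect contains the discrete operator, whose norm is not controlled as the mesh is refined.
  With \<open>e = P w - Q w\<close> and \<open>d = Q w - R z q\<close> the error equation is \<open>(z - Ah) d = Ah e\<close>, so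
  \<open>(z - Ah) (d + e) = z e\<close>: adding \<open>e\<close> to the error removes the discrete operator from the right-hand
  side.
\<close>

lemma norm_resolvent_Ah_diff_le:
  assumes C: "\<And>x. x \<in> S1 \<Longrightarrow> norm x \<le> C * norm (z *\<^sub>C x - Ah x)" and z: "z \<noteq> 0"
    and w: "w \<in> form_dom V a"
  shows "norm (R z (Q (z *\<^sub>C w - A w)) - Q w) \<le> (C * cmod z + 1) * norm (P w - Q w)"
proof -
  define q where "q = Q (z *\<^sub>C w - A w)"
  define y where "y = R z q"
  define e where "e = P w - Q w"
  have q: "q \<in> S1" by (simp add: q_def hproj.proj)
  have y: "z *\<^sub>C y - Ah y = q" "y \<in> S1" unfolding y_def using resolvent_Ah[OF C z q] by auto
  have wV: "w \<in> V" using w form.form_dom_subset by blast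
  have e: "e \<in> S1" unfolding e_def
    using aproj.proj(1)[OF wV] hproj.proj(1)[of w] cvs.subspace_diff[OF S1_subspace] by simp
  have in_S1: "(Q w - y) + e \<in> S1"
    using y(2) e hproj.proj(1)[of w] cvs.subspace_diff[OF S1_subspace] cvs.subspace_add[OF S1_subspace]
    by simp
  have "z *\<^sub>C ((Q w - y) + e) - Ah ((Q w - y) + e) =
      (z *\<^sub>C Q w - Ah (Q w)) - (z *\<^sub>C y - Ah y) + (z *\<^sub>C e - Ah e)"
    by (simp add: Ah_add Ah_diff scaleC_add_right cvs.scale_right_diff_distrib)
  also have "\<dots> = z *\<^sub>C e"
    using Ah_defect[OF w, of z] by (simp add: y(1) q_def e_def)
  finally have "norm ((Q w - y) + e) \<le> C * (cmod z * norm e)"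
    using C[OF in_S1] by (simp add: norm_scaleC)
  moreover have "norm (Q w - y) \<le> norm ((Q w - y) + e) + norm e"
    using norm_triangle_ineq4[of "(Q w - y) + e" e] by simp
  ultimately show ?thesis
    by (simp add: y_def q_def e_def norm_minus_commute algebra_simps)
qed

text \<open>
  From the resolvent identity; it makes the integrand of the Riesz projection integrable.
\<close>

lemma continuous_on_resolvent_Ah:
  assumes C: "\<And>z x. z \<in> Z \<Longrightarrow> x \<in> S1 \<Longrightarrow> norm x \<le> C * norm (z *\<^sub>C x - Ah x)"
    and "0 \<le> C" and Z: "0 \<notin> Z" and q: "q \<in> S1"
  shows "continuous_on Z (\<lambda>z. R z q)"
proof (rule lipschitz_on_continuous_on)
  show "(C * (C * norm q))-lipschitz_on Z (\<lambda>z. R z q)"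
  proof (rule lipschitz_onI)
    fix z w assume z: "z \<in> Z" and w: "w \<in> Z"
    then have nz: "z \<noteq> 0" "w \<noteq> 0" using Z by auto
    note Rz = resolvent_Ah[OF C[OF z] nz(1) q]
    note Rw = resolvent_Ah[OF C[OF w] nz(2) q]
    have "z *\<^sub>C (R z q - R w q) - Ah (R z q - R w q) =
        (z *\<^sub>C R z q - Ah (R z q)) - (w *\<^sub>C R w q - Ah (R w q)) + (w - z) *\<^sub>C R w q"
      by (simp add: Ah_diff cvs.scale_right_diff_distrib cvs.scale_left_diff_distrib)
    also have "\<dots> = (w - z) *\<^sub>C R w q" by (simp add: Rz(1) Rw(1))
    finally have "norm (R z q - R w q) \<le> C * (cmod (w - z) * norm (R w q))"
      using C[OF z, of "R z q - R w q"] cvs.subspace_diff[OF S1_subspace Rz(2) Rw(2)]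
      by (simp add: norm_scaleC)
    also have "\<dots> \<le> C * (cmod (w - z) * (C * norm q))"
      using C[OF w Rw(2)] \<open>0 \<le> C\<close> by (intro mult_left_mono) (auto simp: Rw(1))
    finally show "dist (R z q) (R w q) \<le> C * (C * norm q) * dist z w"
      by (simp add: dist_norm norm_minus_commute mult_ac)
  qed (use \<open>0 \<le> C\<close> in simp)
qed

text \<open>
  Stated with extended reals, since neither factor is known to be finite.  When \<open>w \<in> S1\<close>, both
  projections fix \<open>w\<close>; this is the case in which the quotient in \<^const>\<open>proj_ratio\<close> is \<open>0 / 0\<close>.
\<close>

lemma norm_P_diff_Q_le:
  assumes U: "U \<subseteq> V" and w: "w \<in> U"
  shows "ennreal (norm (P w - Q w)) \<le>
    proj_ratio a S1 S2 U * subspace_gap U S1 * ennreal (norm w)"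
proof (cases "w \<in> S1")
  case True
  then show ?thesis by (simp add: aproj.proj_id hproj.proj_id)
next
  case False
  interpret orth: petrov_galerkin UNIV cinner S1 S1 n
    by (rule petrov_galerkin_orthogonal[OF aproj.S1])
  define d where "d = norm (w - orth_proj S1 w)"
  have "w \<noteq> 0" using False cvs.subspace_0[OF S1_subspace] by auto
  then have w0: "0 < norm w" by simp
  have d0: "0 < d" using False orth.proj(1)[of w] by (auto simp: d_def)
  have "ennreal (d / norm w) \<le> (INF y\<in>S1. ennreal (norm (y - w) / norm w))"
    using norm_diff_orth_proj_le[OF aproj.S1, of _ w]
    by (intro INF_greatest ennreal_leI divide_right_mono) (auto simp: d_def norm_minus_commute)
  also have "\<dots> \<le> subspace_gap U S1"
    unfolding subspace_gap_def by (rule SUP_upper) (use w \<open>w \<noteq> 0\<close> in simp)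
  finally have gap: "ennreal (d / norm w) \<le> subspace_gap U S1" .
  have ratio: "ennreal (norm (P w - Q w) / d) \<le> proj_ratio a S1 S2 U"
    unfolding proj_ratio_def d_def by (rule SUP_upper[OF w])
  have "ennreal (norm (P w - Q w)) =
      ennreal (norm (P w - Q w) / d) * ennreal (d / norm w) * ennreal (norm w)"
    using d0 w0 by (simp flip: ennreal_mult)
  also have "\<dots> \<le> proj_ratio a S1 S2 U * subspace_gap U S1 * ennreal (norm w)"
    by (intro mult_mono ratio gap) auto
  finally show ?thesis .
qed

section \<open>Error of the discrete spectral projection\<close>

text \<open>
  The integral of \<open>Q (w z)\<close>, where \<open>w z = (z - A)\<inverse> u\<close>, over the circle is \<open>2 \<pi> \<i> Q u\<close>, so \<open>Q u\<close> and its
  discrete Riesz projection are integrals of functions that differ by the resolvent error.  The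
  norm of \<open>w z\<close> is bounded by the resolvent bound \<open>K\<close> of \<open>A\<close>, whatever the order of nilpotency.
\<close>

lemma norm_riesz_projection_Q_diff_le:
  assumes U: "U = gen_eigenspace (form_dom V a) A ev" and U_subspace: "cvs.subspace U"
    and r: "0 < r" and origin: "0 \<notin> sphere ev r" and "0 \<le> C" "0 \<le> b"
    and K: "\<And>z x. z \<in> sphere ev r \<Longrightarrow> x \<in> form_dom V a \<Longrightarrow> norm x \<le> K * norm (z *\<^sub>C x - A x)"
    and C: "\<And>z x. z \<in> sphere ev r \<Longrightarrow> x \<in> S1 \<Longrightarrow> norm x \<le> C * norm (z *\<^sub>C x - Ah x)"
    and b: "\<And>w. w \<in> U \<Longrightarrow> norm (P w - Q w) \<le> b * norm w"
    and u: "u \<in> U"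
  shows "norm (riesz_projection UNIV Ah ev r (Q u) - Q u) \<le>
    r * ((C * (cmod ev + r) + 1) * (b * (K * norm u)))"
proof -
  let ?N = "\<lambda>v. A v - ev *\<^sub>C v"
  have UD: "U \<subseteq> form_dom V a" unfolding U by (rule gen_eigenspace_subset_dom)
  have inv: "?N v \<in> U" if "v \<in> U" for v
    using that cvs.subspace_0[OF U_subspace] unfolding U by (rule gen_eigenspace_invariant)
  obtain k where k: "0 < k" "(?N ^^ k) u = 0"
    using gen_eigenspace_nilpotent u unfolding U by blast
  define w where "w = resolvent_sum A ev k u"
  have w: "w z \<in> U" for z unfolding w_def by (rule resolvent_sum_in[OF U_subspace inv u])
  have zw: "z *\<^sub>C w z - A (w z) = u" if "z \<in> sphere ev r" for z
  proof -
    have "z \<noteq> ev" using that r by auto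
    then show ?thesis unfolding w_def
      using resolvent_sum_telescopes[OF U_subspace form.clinear_on_form_op[OF UD] inv u, of z k] k(2)
      by simp
  qed
  have Qw: "Q (w z) = (\<Sum>j<k. inverse ((z - ev) ^ Suc j) *\<^sub>C Q ((?N ^^ j) u))" for z
    unfolding w_def resolvent_sum_def by (intro clinear_on_sum[OF hproj.clinear_on_proj]) auto
  show ?thesis
  proof (rule norm_riesz_projection_diff_le[OF r, where f = "\<lambda>z. Q (w z)"])
    show "continuous_on (sphere ev r) (\<lambda>z. R z (Q u))"
      using C \<open>0 \<le> C\<close> origin by (rule continuous_on_resolvent_Ah)
        (assumption | rule hproj.proj(1)[OF UNIV_I])+
    show "((\<lambda>t. vector_derivative (circlepath ev r) (at t within {0..1}) *\<^sub>C
        Q (w (circlepath ev r t))) has_integral (2 * complex_of_real pi * \<i>) *\<^sub>C Q u) {0..1}"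
      unfolding Qw using has_integral_circlepath_resolvent_sum[OF r k(1), of ev "\<lambda>j. Q ((?N ^^ j) u)"]
      by simp
    fix z assume z: "z \<in> sphere ev r"
    have "z \<noteq> 0" using z origin by blast
    have wD: "w z \<in> form_dom V a" using w UD by blast
    have "cmod z \<le> cmod ev + r"
      using z norm_triangle_ineq2[of z ev] by (simp add: dist_norm norm_minus_commute)
    then have Cz: "C * cmod z + 1 \<le> C * (cmod ev + r) + 1"
      using \<open>0 \<le> C\<close> by (simp add: mult_left_mono)
    have "norm (R z (Q u) - Q (w z)) \<le> (C * cmod z + 1) * norm (P (w z) - Q (w z))"
      using norm_resolvent_Ah_diff_le[OF C[OF z] \<open>z \<noteq> 0\<close> wD] by (simp add: zw[OF z])
    also have "\<dots> \<le> (C * (cmod ev + r) + 1) * norm (P (w z) - Q (w z))"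
      by (rule mult_right_mono[OF Cz norm_ge_zero])
    also have "\<dots> \<le> (C * (cmod ev + r) + 1) * (b * norm (w z))"
      using b[OF w] \<open>0 \<le> C\<close> r by (intro mult_left_mono) auto
    also have "\<dots> \<le> (C * (cmod ev + r) + 1) * (b * (K * norm u))"
      using K[OF z wD] zw[OF z] \<open>0 \<le> C\<close> \<open>0 \<le> b\<close> r by (intro mult_left_mono) auto
    finally show "norm (R z (Q u) - Q (w z)) \<le> (C * (cmod ev + r) + 1) * (b * (K * norm u))" .
  qed
qed

end

theorem theorem6p1:
  fixes V :: "'a::chilbert_space set"
    and a ipV :: "'a \<Rightarrow> 'a \<Rightarrow> complex"
    and \<alpha> M :: real
    and domA :: "'a set" and A :: "'a \<Rightarrow> 'a"
    and ev :: complex and r :: real and m :: nat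
    and U :: "'a set"
    and S1 S2 :: "real \<Rightarrow> 'a set" and N :: "real \<Rightarrow> nat"
    and Q :: "real \<Rightarrow> 'a \<Rightarrow> 'a" and Ah :: "real \<Rightarrow> 'a \<Rightarrow> 'a" and Uh :: "real \<Rightarrow> 'a set"
  assumes separable: "separable_space (euclidean :: 'a topology)"
    and V_subspace: "cvs.subspace V"
    and V_dense: "closure V = UNIV"
    and a_sesquilinear: "sesquilinear_on V a"
    and \<alpha>_pos: "0 < \<alpha>" and M_pos: "0 < M"
    and a_sectorial: "sectorial_form V a \<alpha> M"
    and a_closed: "closed_form V a"
    and V_hilbert: "hilbert_on V ipV"
    and ipV_equivalent: "equivalent_on V ipV (real_part_form a)"
    and domA: "domA = form_dom V a"
    and A: "A = form_op V a"
    and ev_nonzero: "ev \<noteq> 0"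
    and ev_eigenvalue: "eigenvalue domA A ev"
    and ev_isolated: "ev isolated_in spectrum domA A"
    and U: "U = gen_eigenspace domA A ev"
    and U_dim: "has_cdim U m"
    and r_pos: "0 < r"
    and \<Gamma>_origin: "0 \<notin> cball ev r"
    and \<Gamma>_spectrum: "spectrum domA A \<inter> cball ev r = {ev}"
    and U_spectral: "range (riesz_projection domA A ev r) = U"
    and S1_sub: "\<And>h. 0 < h \<Longrightarrow> S1 h \<subseteq> V"
    and S2_sub: "\<And>h. 0 < h \<Longrightarrow> S2 h \<subseteq> V"
    and S1_dim: "\<And>h. 0 < h \<Longrightarrow> has_cdim (S1 h) (N h)"
    and S2_dim: "\<And>h. 0 < h \<Longrightarrow> has_cdim (S2 h) (N h)"
    and beta_pos: "\<And>h. 0 < h \<Longrightarrow> 0 < inf_sup (form_norm ipV) a (S1 h) (S2 h)"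
    and beta0_pos: "\<And>h. 0 < h \<Longrightarrow> 0 < inf_sup norm cinner (S1 h) (S2 h)"
    and Q: "\<And>h. Q h = galerkin_proj cinner (S1 h) (S2 h)"
    and Ah: "\<And>h. Ah h = galerkin_op a (S1 h) (S2 h)"
    and Uh: "\<And>h. Uh h = range (riesz_projection UNIV (Ah h) ev r)"
    and approximation:
      "\<And>v. ((\<lambda>h. inverse (inf_sup norm cinner (S1 h) (S2 h)) * (INF w\<in>S1 h. ennreal (norm (v - w))))
              \<longlongrightarrow> 0) (at_right 0)"
    and gap_convergence:
      "((\<lambda>h. operator_gap (S1 h) (Ah h) domA A) \<longlongrightarrow> 0) (at_right 0)"
  shows "\<exists>h0>0. \<exists>c>0. \<forall>h. 0 < h \<and> h < h0 \<longrightarrow>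
           (\<forall>u\<in>U. norm u = 1 \<longrightarrow>
             (\<exists>uh\<in>Uh h. ennreal (norm (uh - Q h u)) \<le>
                ennreal c * proj_ratio a (S1 h) (S2 h) U * subspace_gap U (S1 h)))"
proof -
  have a_form: "densely_defined_form V a"
    using V_subspace V_dense a_sesquilinear by unfold_locales
  have U_subspace: "cvs.subspace U" using has_cdim_subspace[OF U_dim] .
  have "inner_product_on V ipV" using V_hilbert unfolding hilbert_on_def by blast
  then have ipV: "sesquilinear_on V ipV" "\<And>v. v \<in> V \<Longrightarrow> v \<noteq> 0 \<Longrightarrow> 0 < form_norm ipV v"
    unfolding inner_product_on_def form_norm_def real_sqrt_gt_0_iff by blast+
  have approx: "galerkin_approximation V a (S1 h) (S2 h) (N h)" if h: "0 < h" for h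
  proof -
    have "petrov_galerkin V a (S1 h) (S2 h) (N h)"
      by (rule petrov_galerkin_inf_sup[OF V_subspace a_sesquilinear S1_sub[OF h] S2_sub[OF h]
            S1_dim[OF h] S2_dim[OF h] beta_pos[OF h]])
        (use ipV S2_sub[OF h] form_norm_scaleC[OF ipV(1) _ V_subspace] in \<open>auto simp: subset_iff\<close>)
    moreover have "petrov_galerkin UNIV cinner (S1 h) (S2 h) (N h)"
      using S1_dim[OF h] S2_dim[OF h] beta0_pos[OF h] sesquilinear_cinner
      by (intro petrov_galerkin_inf_sup[of _ _ _ _ _ norm]) (auto simp: norm_scaleC)
    ultimately show ?thesis using a_form by (simp add: galerkin_approximation_def)
  qed
  have sphere: "sphere ev r \<subseteq> resolvent_set domA A"
  proof
    fix z assume "z \<in> sphere ev r"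
    then have "z \<in> cball ev r" "z \<noteq> ev" using r_pos by auto
    then have "z \<notin> spectrum domA A" using \<Gamma>_spectrum by blast
    then show "z \<in> resolvent_set domA A" by (simp add: spectrum_def)
  qed
  obtain K where K: "0 < K"
    "\<And>z x. z \<in> sphere ev r \<Longrightarrow> x \<in> domA \<Longrightarrow> norm x \<le> K * norm (z *\<^sub>C x - A x)"
    using resolvent_bound_compact[OF compact_sphere sphere] by blast
  define \<rho> where "\<rho> = cmod ev + r"
  have \<rho>: "0 < \<rho>" using r_pos by (simp add: \<rho>_def add_nonneg_pos)
  define \<delta> where "\<delta> = 1 / (2 * (1 + \<rho>) * (1 + K * (1 + \<rho>)))"
  have "0 < \<delta>" using K(1) \<rho> by (simp add: \<delta>_def add_pos_pos)
  then have "\<forall>\<^sub>F h in at_right 0. operator_gap (S1 h) (Ah h) domA A < ennreal \<delta>"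
    by (intro order_tendstoD(2)[OF gap_convergence]) simp
  then obtain h0 where h0: "0 < h0"
    "\<And>h. 0 < h \<Longrightarrow> h < h0 \<Longrightarrow> operator_gap (S1 h) (Ah h) domA A < ennreal \<delta>"
    by (auto simp: eventually_at_right_field)
  define C where "C = 2 * K + 1"
  have C0: "0 \<le> C" using K(1) by (simp add: C_def)
  define c where "c = r * (C * \<rho> + 1) * K"
  have c: "0 < c" using r_pos K(1) C0 \<rho> by (simp add: c_def add_nonneg_pos)
  show ?thesis
  proof (intro exI conjI allI impI ballI, rule h0(1), rule c, elim conjE)
    fix h u assume h: "0 < h" "h < h0" and u: "u \<in> U" "norm u = 1"
    interpret galerkin_approximation V a "S1 h" "S2 h" "N h" by (rule approx[OF h(1)])
    have C: "norm x \<le> C * norm (z *\<^sub>C x - Ah h x)" if z: "z \<in> sphere ev r" and x: "x \<in> S1 h" for z x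
    proof -
      have "cmod z \<le> \<rho>"
        using z norm_triangle_ineq2[of z ev] by (simp add: \<rho>_def dist_norm norm_minus_commute)
      then show ?thesis unfolding C_def
        using resolvent_bound_operator_gap[OF K(1) K(2)[OF z] _ \<rho> h0(2)[OF h, unfolded \<delta>_def] x] by blast
    qed
    define \<epsilon> where "\<epsilon> = proj_ratio a (S1 h) (S2 h) U * subspace_gap U (S1 h)"
    have UV: "U \<subseteq> V"
      using gen_eigenspace_subset_dom[of domA A ev] form.form_dom_subset by (auto simp: U domA)
    define uh where "uh = riesz_projection UNIV (Ah h) ev r (Q h u)"
    have "uh \<in> Uh h" by (simp add: uh_def Uh)
    moreover have "ennreal (norm (uh - Q h u)) \<le> ennreal c * \<epsilon>"
    \<comment> \<open>An infinite right-hand side leaves nothing to prove; a finite one gives a real constant.\<close>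
    proof (cases \<epsilon>)
      case (real b)
      have "norm (uh - Q h u) \<le> r * ((C * (cmod ev + r) + 1) * (b * (K * norm u)))"
        unfolding uh_def Q Ah
      proof (rule norm_riesz_projection_Q_diff_le)
        show "U = gen_eigenspace (form_dom V a) (form_op V a) ev" by (simp add: U domA A)
        show "0 \<notin> sphere ev r" using \<Gamma>_origin by auto
        show "norm x \<le> K * norm (z *\<^sub>C x - form_op V a x)"
          if "z \<in> sphere ev r" "x \<in> form_dom V a" for z x using K(2) that by (simp add: domA A)
        show "norm x \<le> C * norm (z *\<^sub>C x - galerkin_op a (S1 h) (S2 h) x)"
          if "z \<in> sphere ev r" "x \<in> S1 h" for z x using C that by (simp add: Ah)
        show "norm (galerkin_proj a (S1 h) (S2 h) w - galerkin_proj cinner (S1 h) (S2 h) w) \<le> b * norm w"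
          if "w \<in> U" for w
          using norm_P_diff_Q_le[OF UV that] real by (simp add: \<epsilon>_def flip: ennreal_mult)
      qed (use U_subspace r_pos C0 real u in auto)
      also have "\<dots> = c * b" using u(2) by (simp add: c_def \<rho>_def)
      finally show ?thesis using real c by (simp flip: ennreal_mult)
    next
      case top
      then show ?thesis using c by (simp add: ennreal_mult_top)
    qed
    ultimately show "\<exists>uh\<in>Uh h. ennreal (norm (uh - Q h u)) \<le>
        ennreal c * proj_ratio a (S1 h) (S2 h) U * subspace_gap U (S1 h)"
      by (auto simp: \<epsilon>_def mult.assoc)
  qed
qed

end
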